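(* Let a first PIE $\mathbf{G}_1$, with state $\mathbf{v}(t)\in\mathrm{Z}^{\mathrm{n}_1}$, inputs $\mathbf{w}(t)\in\mathrm{Z}^{\mathrm{n}_w}$, $\mathbf{r}(t)\in\mathrm{Z}^{\mathrm{n}_r}$ and outputs $\mathbf{z}(t)\in\mathrm{Z}^{\mathrm{n}_z}$, $\mathbf{q}(t)\in\mathrm{Z}^{\mathrm{n}_q}$, be given by $$\mathbf{G}_1:\quad\begin{aligned}\mathcal{T}_{1r}\mathbf{r}_t+\mathcal{T}_{1w}\mathbf{w}_t+\mathcal{T}_1\mathbf{v}_t&=\mathcal{A}_1\mathbf{v}+\mathcal{B}_{1w}\mathbf{w}+\mathcal{B}_{1r}\mathbf{r},\\ \mathbf{z}&=\mathcal{C}_{z1}\mathbf{v}+\mathcal{D}_{zw}\mathbf{w}+\mathcal{D}_{zr}\mathbf{r},\\ \mathbf{q}&=\mathcal{C}_{q1}\mathbf{v}+\mathcal{D}_{qw}\mathbf{w},\end{aligned}$$ and a second PIE $\mathbf{G}_2$, with state $\boldsymbol\psi(t)\in\mathrm{Z}^{\mathrm{n}_2}$, input $\mathbf{q}$ and output $\mathbf{r}$, by $$\mathbf{G}_2:\quad\mathcal{T}_{2q}\mathbf{q}_t+\mathcal{T}_2\boldsymbol\psi_t=\mathcal{A}_2\boldsymbol\psi+\mathcal{B}_{2q}\mathbf{q},\qquad\mathbf{r}=\mathcal{C}_{r2}\boldsymbol\psi+\mathcal{D}_{rq}\mathbf{q},$$ where $\mathrm{n}_1,\mathrm{n}_2,\mathrm{n}_w,\mathrm{n}_z,\mathrm{n}_q,\mathrm{n}_r\in\mathbb{N}^4$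 and all operators are PI operators of compatible dimensions. Define the associated PIE interconnection $\mathbf{G}=\{\mathcal{T},\mathcal{T}_w,\mathcal{A},\mathcal{B}_w,\mathcal{C}_z,\mathcal{D}\}$ by $$\mathcal{T}=\begin{bmatrix}\mathcal{T}_1+\mathcal{T}_{1r}\mathcal{D}_{rq}\mathcal{C}_{q1}&\mathcal{T}_{1r}\mathcal{C}_{r2}\\ \mathcal{T}_{2q}\mathcal{C}_{q1}&\mathcal{T}_2\end{bmatrix},\quad\mathcal{T}_w=\begin{bmatrix}\mathcal{T}_{1w}+\mathcal{T}_{1r}\mathcal{D}_{rq}\mathcal{D}_{qw}\\ \mathcal{T}_{2q}\mathcal{D}_{qw}\end{bmatrix},$$ $$\mathcal{A}=\begin{bmatrix}\mathcal{A}_1+\mathcal{B}_{1r}\mathcal{D}_{rq}\mathcal{C}_{q1}&\mathcal{B}_{1r}\mathcal{C}_{r2}\\ \mathcal{B}_{2q}\mathcal{C}_{q1}&\mathcal{A}_2\end{bmatrix},\quad\mathcal{B}_w=\begin{bmatrix}\mathcal{B}_{1w}+\mathcal{B}_{1r}\mathcal{D}_{rq}\mathcal{D}_{qw}\\ \mathcal{B}_{2q}\mathcal{D}_{qw}\end{bmatrix},$$ $$\mathcal{C}_z=\begin{bmatrix}\mathcal{C}_{z1}+\mathcal{D}_{zr}\mathcal{D}_{rq}\mathcal{C}_{q1}&\mathcal{D}_{zr}\mathcal{C}_{r2}\end{bmatrix},\quad\mathcal{D}=\mathcal{D}_{zw}+\mathcal{D}_{zr}\mathcal{D}_{rq}\mathcal{D}_{qw}.$$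 Then $\left(\begin{bmatrix}\mathbf{v}\\ \boldsymbol\psi\end{bmatrix},\mathbf{z}\right)$ solves the PIE defined by $\mathbf{G}$ with initial conditions $\begin{bmatrix}\mathbf{v}_0\\ \boldsymbol\psi_0\end{bmatrix}$ and input $\mathbf{w}$ if and only if $(\mathbf{v},\mathbf{z},\mathbf{q})$ and $(\boldsymbol\psi,\mathbf{r})$ solve the PIEs $\mathbf{G}_1$ and $\mathbf{G}_2$ with initial conditions $\mathbf{v}_0$ and $\boldsymbol\psi_0$ and inputs $(\mathbf{w},\mathbf{r})$ and $\mathbf{q}$, respectively, where $$\mathbf{q}(t)=\mathcal{C}_{q1}\mathbf{v}(t)+\mathcal{D}_{qw}\mathbf{w}(t),\qquad\mathbf{r}(t)=\mathcal{C}_{r2}\boldsymbol\psi(t)+\mathcal{D}_{rq}\bigl(\mathcal{C}_{q1}\mathbf{v}(t)+\mathcal{D}_{qw}\mathbf{w}(t)\bigr).$$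
   Context: Let $\Omega_1=[a,b]$, $\Omega_2=[c,d]$. For $\mathrm{n}=(n_0,n_1,n_2,n_3)\in\mathbb{N}^4$, $\mathrm{Z}^{\mathrm n}=\mathbb{R}^{n_0}\times L_2^{n_1}[\Omega_1]\times L_2^{n_2}[\Omega_2]\times L_2^{n_3}[\Omega_1\times\Omega_2]$. $\mathrm{Z}^{\mathrm{n}_1}\times\mathrm{Z}^{\mathrm{n}_2}$ is identified with $\mathrm{Z}^{\mathrm{n}_1+\mathrm{n}_2}$ by reordering components. PI operators. A 4-PI operator (in the variable $x\in\Omega_1$) is an operator mapping $(u_0,\mathbf{u}_1)\in\mathbb{R}^{n_0}\times L_2^{n_1}[\Omega_1]$ to $$\Bigl(B_{00}u_0+\int_a^bB_{01}(x)\mathbf{u}_1(x)dx,\ \ B_{10}(x)u_0+R_0(x)\mathbf{u}_1(x)+\int_a^xR_1(x,\theta)\mathbf{u}_1(\theta)d\theta+\int_x^bR_2(x,\theta)\mathbf{u}_1(\theta)d\theta\Bigr),$$ with $B_{00}$ a real matrix and matrix-valued functions $B_{01},B_{10}\in L_2[\Omega_1]$, $R_0\in L_\infty[\Omega_1]$, $R_1,R_2\in L_2[\Omega_1\times\Omega_1]$. A 4-PI operator also acts on pairs in $L_2^{n_2}[\Omega_2]\times L_2^{n_3}[\Omega_1\times\Omega_2]$, pointwise in the second variable $y\in\Omega_2$ (i.e. as a multiplier along $y$). Write an element of $\mathrm{Z}^{\mathrm n}$ as $(\mathbf{p}_1,\mathbf{p}_2)$ with $\mathbf{p}_1\in\mathbb{R}^{n_0}\times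 L_2^{n_1}[\Omega_1]$ and $\mathbf{p}_2\in L_2^{n_2}[\Omega_2]\times L_2^{n_3}[\Omega_1\times\Omega_2]$. A PI operator from $\mathrm{Z}^{\mathrm n}$ to $\mathrm{Z}^{\mathrm m}$ is an operator of the form $$(\mathbf{p}_1,\mathbf{p}_2)\mapsto\Bigl(\mathcal{B}_{11}\mathbf{p}_1+\int_c^d(\mathcal{B}_{12}\mathbf{p}_2)(y)dy,\ \ \mathcal{B}_{21}\mathbf{p}_1+(\mathcal{N}_0\mathbf{p}_2)(y)+\int_c^y(\mathcal{N}_1\mathbf{p}_2)(\nu)d\nu+\int_y^d(\mathcal{N}_2\mathbf{p}_2)(\nu)d\nu\Bigr),$$ where $\mathcal{B}_{11},\mathcal{B}_{12},\mathcal{B}_{21},\mathcal{N}_0,\mathcal{N}_1,\mathcal{N}_2$ are 4-PI operators of appropriate dimensions (with parameters not depending on $y,\nu$). PIE and solutions. The PIE (partial integral equation) defined by $\mathbf{G}=\{\mathcal{T},\mathcal{T}_w,\mathcal{A},\mathcal{B}_w,\mathcal{C}_z,\mathcal{D}\}$ with state $\mathbf{x}$, input $\mathbf{w}$, output $\mathbf{z}$ is $\mathcal{T}_w\mathbf{w}_t+\mathcal{T}\mathbf{x}_t=\mathcal{A}\mathbf{x}+\mathcal{B}_w\mathbf{w}$, $\mathbf{z}=\mathcal{C}_z\mathbf{x}+\mathcal{D}\mathbf{w}$. For each PIE considered here, given input signals and initial conditions, a solution consists of a Fréchet differentiable state that attains the initial conditions at $t=0$, together with outputs, such that all equations of the PIE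 hold for all $t\ge0$. *)

theory Defs
  imports "HOL-Analysis.Analysis" "HOL-Library.Function_Algebras"
begin

text \<open>
  The dimensions range over the natural numbers and may be zero, so vectors and matrices are
  indexed by \<^typ>\<open>nat\<close>; of a vector in dimension \<open>n\<close> only the entries with index below \<open>n\<close> are
  ever looked at.  Square integrable functions are handled through representatives:
  \<open>Zspace\<close> is the set of (Borel measurable) representatives of the elements of $\mathrm{Z}^n$,
  and equality in $\mathrm{Z}^n$ is the relation \<open>zeq\<close>.  Sums, differences and compositions of
  operators are the pointwise ones from \<^theory>\<open>HOL-Library.Function_Algebras\<close>.
\<close>

type_synonym vec = "nat \<Rightarrow> real"
type_synonym mat = "nat \<Rightarrow> nat \<Rightarrow> real"

definition mat_vec :: "nat \<Rightarrow> mat \<Rightarrow> vec \<Rightarrow> vec" where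
  "mat_vec n M u = (\<lambda>i. \<Sum>j<n. M i j * u j)"

abbreviation leb :: "real \<Rightarrow> real \<Rightarrow> real measure" where
  "leb a b \<equiv> restrict_space lborel {a..b}"

definition L2 :: "'a measure \<Rightarrow> ('a \<Rightarrow> real) set" where
  "L2 M = {f \<in> borel_measurable M. integrable M (\<lambda>x. (f x)\<^sup>2)}"

definition Linf :: "'a measure \<Rightarrow> ('a \<Rightarrow> real) set" where
  "Linf M = {f \<in> borel_measurable M. \<exists>K. AE x in M. \<bar>f x\<bar> \<le> K}"

section \<open>The spaces\<close>

text \<open>
  A pair \<open>(u\<^sub>0, u\<^sub>1)\<close> of type \<open>rl\<close> stands for an element of
  $\mathbb{R}^{n_0} \times L_2^{n_1}[a,b]$.  An element of $\mathrm{Z}^n$ is a pair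
  \<open>(p\<^sub>1, p\<^sub>2)\<close> in which \<open>p\<^sub>2 y\<close> collects the values at \<open>y\<close> of the components in
  $L_2^{n_2}[c,d]$ and $L_2^{n_3}([a,b]\times[c,d])$: the latter is
  \<open>\<lambda>(x, y). snd (p\<^sub>2 y) x\<close>.
\<close>

type_synonym rl = "vec \<times> (real \<Rightarrow> vec)"
type_synonym zfun = "rl \<times> (real \<Rightarrow> rl)"
type_synonym dim4 = "nat \<times> nat \<times> nat \<times> nat"

fun Zspace :: "real \<Rightarrow> real \<Rightarrow> real \<Rightarrow> real \<Rightarrow> dim4 \<Rightarrow> zfun set" where
  "Zspace a b c d (n0, n1, n2, n3) =
     {((u0, u1), p2).
        (\<forall>i<n1. (\<lambda>x. u1 x i) \<in> L2 (leb a b)) \<and>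
        (\<forall>i<n2. (\<lambda>y. fst (p2 y) i) \<in> L2 (leb c d)) \<and>
        (\<forall>i<n3. (\<lambda>(x, y). snd (p2 y) x i) \<in> L2 (leb a b \<Otimes>\<^sub>M leb c d))}"

fun zeq :: "real \<Rightarrow> real \<Rightarrow> real \<Rightarrow> real \<Rightarrow> dim4 \<Rightarrow> zfun \<Rightarrow> zfun \<Rightarrow> bool" where
  "zeq a b c d (n0, n1, n2, n3) ((u0, u1), p2) ((v0, v1), q2) \<longleftrightarrow>
     (\<forall>i<n0. u0 i = v0 i) \<and>
     (\<forall>i<n1. AE x in leb a b. u1 x i = v1 x i) \<and>
     (\<forall>i<n2. AE y in leb c d. fst (p2 y) i = fst (q2 y) i) \<and>
     (\<forall>i<n3. AE (x, y) in leb a b \<Otimes>\<^sub>M leb c d. snd (p2 y) x i = snd (q2 y) x i)"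

fun znorm :: "real \<Rightarrow> real \<Rightarrow> real \<Rightarrow> real \<Rightarrow> dim4 \<Rightarrow> zfun \<Rightarrow> real" where
  "znorm a b c d (n0, n1, n2, n3) ((u0, u1), p2) =
     sqrt ((\<Sum>i<n0. (u0 i)\<^sup>2)
         + (\<Sum>i<n1. LINT x|leb a b. (u1 x i)\<^sup>2)
         + (\<Sum>i<n2. LINT y|leb c d. (fst (p2 y) i)\<^sup>2)
         + (\<Sum>i<n3. LINT (x, y)|(leb a b \<Otimes>\<^sub>M leb c d). (snd (p2 y) x i)\<^sup>2))"

definition rl_scale :: "real \<Rightarrow> rl \<Rightarrow> rl" where
  "rl_scale k u = ((\<lambda>i. k * fst u i), (\<lambda>x i. k * snd u x i))"

definition zscale :: "real \<Rightarrow> zfun \<Rightarrow> zfun" where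
  "zscale k p = (rl_scale k (fst p), (\<lambda>y. rl_scale k (snd p y)))"

text \<open>
  \<open>x'\<close> is the (Frechet) derivative at \<open>t\<close>, relative to $[0,\infty)$, of the curve \<open>x\<close>;
  this is what \<^const>\<open>has_derivative\<close> says for the linear map \<open>\<lambda>h. zscale h x'\<close>, which cannot
  be used itself because the norm depends on the domain and on the dimensions.
\<close>

definition zderiv ::
  "real \<Rightarrow> real \<Rightarrow> real \<Rightarrow> real \<Rightarrow> dim4 \<Rightarrow> (real \<Rightarrow> zfun) \<Rightarrow> zfun \<Rightarrow> real \<Rightarrow> bool" where
  "zderiv a b c d n x x' t \<longleftrightarrow>
     x' \<in> Zspace a b c d n \<and>
     ((\<lambda>s. znorm a b c d n (x s - x t - zscale (s - t) x') / \<bar>s - t\<bar>) \<longlongrightarrow> 0)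
       (at t within {0..})"

section \<open>PI operators\<close>

record pi4_params =
  B00 :: mat
  B01 :: "real \<Rightarrow> mat"
  B10 :: "real \<Rightarrow> mat"
  R0 :: "real \<Rightarrow> mat"
  R1 :: "real \<Rightarrow> real \<Rightarrow> mat"
  R2 :: "real \<Rightarrow> real \<Rightarrow> mat"

fun pi4_ok :: "real \<Rightarrow> real \<Rightarrow> nat \<times> nat \<Rightarrow> nat \<times> nat \<Rightarrow> pi4_params \<Rightarrow> bool" where
  "pi4_ok a b (n0, n1) (m0, m1) P \<longleftrightarrow>
     (\<forall>i<m0. \<forall>j<n1. (\<lambda>x. B01 P x i j) \<in> L2 (leb a b)) \<and>
     (\<forall>i<m1. \<forall>j<n0. (\<lambda>x. B10 P x i j) \<in> L2 (leb a b)) \<and>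
     (\<forall>i<m1. \<forall>j<n1.
        (\<lambda>x. R0 P x i j) \<in> Linf (leb a b) \<and>
        (\<lambda>(x, \<theta>). R1 P x \<theta> i j) \<in> L2 (leb a b \<Otimes>\<^sub>M leb a b) \<and>
        (\<lambda>(x, \<theta>). R2 P x \<theta> i j) \<in> L2 (leb a b \<Otimes>\<^sub>M leb a b))"

fun pi4_map :: "real \<Rightarrow> real \<Rightarrow> nat \<times> nat \<Rightarrow> pi4_params \<Rightarrow> rl \<Rightarrow> rl" where
  "pi4_map a b (n0, n1) P (u0, u1) =
     ((\<lambda>i. mat_vec n0 (B00 P) u0 i
         + (LINT x:{a..b}|lborel. mat_vec n1 (B01 P x) (u1 x) i)),
      (\<lambda>x i. mat_vec n0 (B10 P x) u0 i
         + mat_vec n1 (R0 P x) (u1 x) i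
         + (LINT \<theta>:{a..x}|lborel. mat_vec n1 (R1 P x \<theta>) (u1 \<theta>) i)
         + (LINT \<theta>:{x..b}|lborel. mat_vec n1 (R2 P x \<theta>) (u1 \<theta>) i)))"

definition is_4PI ::
  "real \<Rightarrow> real \<Rightarrow> nat \<times> nat \<Rightarrow> nat \<times> nat \<Rightarrow> (rl \<Rightarrow> rl) \<Rightarrow> bool" where
  "is_4PI a b n m F \<longleftrightarrow> (\<exists>P. pi4_ok a b n m P \<and> F = pi4_map a b n P)"

definition rl_integral :: "real set \<Rightarrow> (real \<Rightarrow> rl) \<Rightarrow> rl" where
  "rl_integral S f = ((\<lambda>i. LINT y:S|lborel. fst (f y) i), (\<lambda>x i. LINT y:S|lborel. snd (f y) x i))"

fun is_PI :: "real \<Rightarrow> real \<Rightarrow> real \<Rightarrow> real \<Rightarrow> dim4 \<Rightarrow> dim4 \<Rightarrow> (zfun \<Rightarrow> zfun) \<Rightarrow> bool" where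
  "is_PI a b c d (n0, n1, n2, n3) (m0, m1, m2, m3) F \<longleftrightarrow>
     (\<exists>B11 B12 B21 N0 N1 N2.
        is_4PI a b (n0, n1) (m0, m1) B11 \<and>
        is_4PI a b (n2, n3) (m0, m1) B12 \<and>
        is_4PI a b (n0, n1) (m2, m3) B21 \<and>
        is_4PI a b (n2, n3) (m2, m3) N0 \<and>
        is_4PI a b (n2, n3) (m2, m3) N1 \<and>
        is_4PI a b (n2, n3) (m2, m3) N2 \<and>
        F = (\<lambda>(p1, p2).
               (B11 p1 + rl_integral {c..d} (\<lambda>y. B12 (p2 y)),
                \<lambda>y. B21 p1 + N0 (p2 y)
                    + rl_integral {c..y} (\<lambda>\<nu>. N1 (p2 \<nu>))
                    + rl_integral {y..d} (\<lambda>\<nu>. N2 (p2 \<nu>)))))"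

section \<open>Block operators\<close>

text \<open>
  The identification of $\mathrm{Z}^n \times \mathrm{Z}^m$ with $\mathrm{Z}^{n+m}$: \<open>zappend n\<close>,
  with inverse \<open>\<lambda>x. (ztake n x, zdrop n x)\<close>, concatenates the components of each of the four
  kinds separately.
\<close>

definition vec_append :: "nat \<Rightarrow> vec \<Rightarrow> vec \<Rightarrow> vec" where
  "vec_append n u v = (\<lambda>i. if i < n then u i else v (i - n))"

definition vec_take :: "nat \<Rightarrow> vec \<Rightarrow> vec" where
  "vec_take n u = (\<lambda>i. if i < n then u i else 0)"

definition vec_drop :: "nat \<Rightarrow> vec \<Rightarrow> vec" where
  "vec_drop n u = (\<lambda>i. u (n + i))"

fun zappend :: "dim4 \<Rightarrow> zfun \<Rightarrow> zfun \<Rightarrow> zfun" where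
  "zappend (n0, n1, n2, n3) ((u0, u1), p2) ((v0, v1), q2) =
     ((vec_append n0 u0 v0, \<lambda>x. vec_append n1 (u1 x) (v1 x)),
      \<lambda>y. (vec_append n2 (fst (p2 y)) (fst (q2 y)),
           \<lambda>x. vec_append n3 (snd (p2 y) x) (snd (q2 y) x)))"

fun ztake :: "dim4 \<Rightarrow> zfun \<Rightarrow> zfun" where
  "ztake (n0, n1, n2, n3) ((u0, u1), p2) =
     ((vec_take n0 u0, \<lambda>x. vec_take n1 (u1 x)),
      \<lambda>y. (vec_take n2 (fst (p2 y)), \<lambda>x. vec_take n3 (snd (p2 y) x)))"

fun zdrop :: "dim4 \<Rightarrow> zfun \<Rightarrow> zfun" where
  "zdrop (n0, n1, n2, n3) ((u0, u1), p2) =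
     ((vec_drop n0 u0, \<lambda>x. vec_drop n1 (u1 x)),
      \<lambda>y. (vec_drop n2 (fst (p2 y)), \<lambda>x. vec_drop n3 (snd (p2 y) x)))"

definition block_row ::
  "dim4 \<Rightarrow> (zfun \<Rightarrow> zfun) \<Rightarrow> (zfun \<Rightarrow> zfun) \<Rightarrow> zfun \<Rightarrow> zfun" where
  "block_row n F G = (\<lambda>x. F (ztake n x) + G (zdrop n x))"

definition block_col ::
  "dim4 \<Rightarrow> (zfun \<Rightarrow> zfun) \<Rightarrow> (zfun \<Rightarrow> zfun) \<Rightarrow> zfun \<Rightarrow> zfun" where
  "block_col m F G = (\<lambda>x. zappend m (F x) (G x))"

section \<open>Partial integral equations\<close>

record pie =
  opT :: "zfun \<Rightarrow> zfun"
  opTw :: "zfun \<Rightarrow> zfun"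
  opA :: "zfun \<Rightarrow> zfun"
  opBw :: "zfun \<Rightarrow> zfun"
  opCz :: "zfun \<Rightarrow> zfun"
  opD :: "zfun \<Rightarrow> zfun"

definition is_pie ::
  "real \<Rightarrow> real \<Rightarrow> real \<Rightarrow> real \<Rightarrow> dim4 \<Rightarrow> dim4 \<Rightarrow> dim4 \<Rightarrow> pie \<Rightarrow> bool" where
  "is_pie a b c d nx nw nz G \<longleftrightarrow>
     is_PI a b c d nx nx (opT G) \<and> is_PI a b c d nw nx (opTw G) \<and>
     is_PI a b c d nx nx (opA G) \<and> is_PI a b c d nw nx (opBw G) \<and>
     is_PI a b c d nx nz (opCz G) \<and> is_PI a b c d nw nz (opD G)"

text \<open>
  The time derivatives occurring in the equation, that of the input included, are required to
  exist for all \<open>t \<ge> 0\<close>.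
\<close>

definition solves_pie ::
  "real \<Rightarrow> real \<Rightarrow> real \<Rightarrow> real \<Rightarrow> dim4 \<Rightarrow> dim4 \<Rightarrow> dim4 \<Rightarrow> pie \<Rightarrow>
   zfun \<Rightarrow> (real \<Rightarrow> zfun) \<Rightarrow> (real \<Rightarrow> zfun) \<Rightarrow> (real \<Rightarrow> zfun) \<Rightarrow> bool" where
  "solves_pie a b c d nx nw nz G x0 w x z \<longleftrightarrow>
     (\<forall>t\<ge>0. x t \<in> Zspace a b c d nx \<and> z t \<in> Zspace a b c d nz) \<and>
     zeq a b c d nx (x 0) x0 \<and>
     (\<forall>t\<ge>0. \<exists>xt wt.
        zderiv a b c d nx x xt t \<and> zderiv a b c d nw w wt t \<and>
        zeq a b c d nx (opTw G wt + opT G xt) (opA G (x t) + opBw G (w t)) \<and>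
        zeq a b c d nz (z t) (opCz G (x t) + opD G (w t)))"

text \<open>A PIE with two inputs \<open>w\<close>, \<open>r\<close> and two outputs \<open>z\<close>, \<open>q\<close>, without feedthrough from \<open>r\<close> to \<open>q\<close>.\<close>

record pie2 =
  T1r :: "zfun \<Rightarrow> zfun"
  T1w :: "zfun \<Rightarrow> zfun"
  T1 :: "zfun \<Rightarrow> zfun"
  A1 :: "zfun \<Rightarrow> zfun"
  B1w :: "zfun \<Rightarrow> zfun"
  B1r :: "zfun \<Rightarrow> zfun"
  Cz1 :: "zfun \<Rightarrow> zfun"
  Dzw :: "zfun \<Rightarrow> zfun"
  Dzr :: "zfun \<Rightarrow> zfun"
  Cq1 :: "zfun \<Rightarrow> zfun"
  Dqw :: "zfun \<Rightarrow> zfun"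

definition is_pie2 ::
  "real \<Rightarrow> real \<Rightarrow> real \<Rightarrow> real \<Rightarrow> dim4 \<Rightarrow> dim4 \<Rightarrow> dim4 \<Rightarrow> dim4 \<Rightarrow> dim4 \<Rightarrow> pie2 \<Rightarrow> bool" where
  "is_pie2 a b c d nv nw nr nz nq G \<longleftrightarrow>
     is_PI a b c d nr nv (T1r G) \<and> is_PI a b c d nw nv (T1w G) \<and> is_PI a b c d nv nv (T1 G) \<and>
     is_PI a b c d nv nv (A1 G) \<and> is_PI a b c d nw nv (B1w G) \<and> is_PI a b c d nr nv (B1r G) \<and>
     is_PI a b c d nv nz (Cz1 G) \<and> is_PI a b c d nw nz (Dzw G) \<and> is_PI a b c d nr nz (Dzr G) \<and>
     is_PI a b c d nv nq (Cq1 G) \<and> is_PI a b c d nw nq (Dqw G)"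

definition solves_pie2 ::
  "real \<Rightarrow> real \<Rightarrow> real \<Rightarrow> real \<Rightarrow> dim4 \<Rightarrow> dim4 \<Rightarrow> dim4 \<Rightarrow> dim4 \<Rightarrow> dim4 \<Rightarrow> pie2 \<Rightarrow>
   zfun \<Rightarrow> (real \<Rightarrow> zfun) \<Rightarrow> (real \<Rightarrow> zfun) \<Rightarrow>
   (real \<Rightarrow> zfun) \<Rightarrow> (real \<Rightarrow> zfun) \<Rightarrow> (real \<Rightarrow> zfun) \<Rightarrow> bool" where
  "solves_pie2 a b c d nv nw nr nz nq G v0 w r v z q \<longleftrightarrow>
     (\<forall>t\<ge>0. v t \<in> Zspace a b c d nv \<and> z t \<in> Zspace a b c d nz \<and> q t \<in> Zspace a b c d nq) \<and>
     zeq a b c d nv (v 0) v0 \<and>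
     (\<forall>t\<ge>0. \<exists>vt wt rt.
        zderiv a b c d nv v vt t \<and> zderiv a b c d nw w wt t \<and> zderiv a b c d nr r rt t \<and>
        zeq a b c d nv (T1r G rt + T1w G wt + T1 G vt)
                       (A1 G (v t) + B1w G (w t) + B1r G (r t)) \<and>
        zeq a b c d nz (z t) (Cz1 G (v t) + Dzw G (w t) + Dzr G (r t)) \<and>
        zeq a b c d nq (q t) (Cq1 G (v t) + Dqw G (w t)))"

text \<open>
  \<open>n1\<close> is the dimension of the state of \<open>G1\<close>.  The operators $\mathcal{T}_{2q}$,
  $\mathcal{B}_{2q}$, $\mathcal{C}_{r2}$, $\mathcal{D}_{rq}$ of the second system are
  \<open>opTw G2\<close>, \<open>opBw G2\<close>, \<open>opCz G2\<close>, \<open>opD G2\<close>.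
\<close>

definition interconnection :: "dim4 \<Rightarrow> pie2 \<Rightarrow> pie \<Rightarrow> pie" where
  "interconnection n1 G1 G2 = \<lparr>
     opT = block_col n1
       (block_row n1 (T1 G1 + (T1r G1 \<circ> opD G2 \<circ> Cq1 G1)) (T1r G1 \<circ> opCz G2))
       (block_row n1 (opTw G2 \<circ> Cq1 G1)                    (opT G2)),
     opTw = block_col n1
       (T1w G1 + (T1r G1 \<circ> opD G2 \<circ> Dqw G1))
       (opTw G2 \<circ> Dqw G1),
     opA = block_col n1
       (block_row n1 (A1 G1 + (B1r G1 \<circ> opD G2 \<circ> Cq1 G1)) (B1r G1 \<circ> opCz G2))
       (block_row n1 (opBw G2 \<circ> Cq1 G1)                    (opA G2)),
     opBw = block_col n1
       (B1w G1 + (B1r G1 \<circ> opD G2 \<circ> Dqw G1))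
       (opBw G2 \<circ> Dqw G1),
     opCz = block_row n1 (Cz1 G1 + (Dzr G1 \<circ> opD G2 \<circ> Cq1 G1)) (Dzr G1 \<circ> opCz G2),
     opD = Dzw G1 + (Dzr G1 \<circ> opD G2 \<circ> Dqw G1) \<rparr>"

end

theory Submission
  imports Defs
begin

text \<open>
  Once PI operators are known to be bounded linear maps between the spaces $\mathrm{Z}^n$, the theorem
  is linear algebra.  The signals $q = C_{q1} v + D_{qw} w$ and $r = C_{r2}\psi + D_{rq} q$ are bounded linear
  images of $v$, $\psi$ and $w$, so they are differentiable whenever these are, and their derivatives
  satisfy the same two relations (\<open>signal_derivatives\<close>); as derivatives are unique up to equality
  almost everywhere, any derivatives of $q$ and $r$ that a solution of the two separate systems
  comes with satisfy them too (\<open>sqderiv_unique\<close>).  Substituting the relations for $q$, $r$ and those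
  for $q_t$, $r_t$ into the equations of the two systems and multiplying out gives the two block
  rows of the interconnection (\<open>interconnection_reduces\<close>), and a curve in $\mathrm{Z}^{n_1+n_2}$ has a
  derivative exactly when its two parts have one (\<open>sqderiv_zappend_iff\<close>).  Read backwards, the same
  argument gives the converse.

  The work lies in the boundedness of PI operators, \<open>bounded_op_PI\<close>.  Elements of $L_2$ are handled
  through representatives, on which an integral operator is linear only almost everywhere, since the
  integral of a non-integrable function is 0.  Therefore linear maps are considered between
  spaces with a squared seminorm, and linearity is demanded up to elements of seminorm 0
  (\<open>bounded_op\<close>).  Such maps are closed under sums and compositions, and every PI
  operator arises by sums and compositions from two kinds of operators: multiplication combined with a
  change of variables (\<open>bounded_op_pointwise_matrix\<close>), and integration against a kernel, with further
  variables as parameters (\<open>bounded_op_integral_matrix\<close>).  The latter is bounded by the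
  Cauchy-Schwarz inequality and Fubini's theorem.
\<close>

section \<open>Seminormed spaces and bounded linear maps between them\<close>

instantiation "fun" :: (type, real_vector) real_vector
begin
definition scaleR_fun_def: "scaleR k f = (\<lambda>x. k *\<^sub>R f x)"
instance
  by standard (auto simp: scaleR_fun_def plus_fun_def scaleR_add_right scaleR_add_left)
end

text \<open>
  A space of representatives of square integrable functions is a linear space with the square of a
  seminorm, which is degenerate because functions that agree almost everywhere are distinct as
  representatives.  Carrier and squared seminorm are kept together in a pair, so that one lemma
  serves all dimensions and all domains.  The square rather than the seminorm is used because it
  is additive over components; the bound $|x+y|^2 \<le> 2|x|^2 + 2|y|^2$, which holds pointwise for
  real numbers, then plays the part of the triangle inequality.
\<close>
type_synonym 'a sqspace = "'a set \<times> ('a \<Rightarrow> real)"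

definition carr :: "'a sqspace \<Rightarrow> 'a set" where "carr = fst"
definition sqnorm :: "'a sqspace \<Rightarrow> 'a \<Rightarrow> real" where "sqnorm = snd"

lemma carr_sqnorm_Pair [simp]: "carr (S, Q) = S" "sqnorm (S, Q) = Q"
  by (simp_all add: carr_def sqnorm_def)

definition sqspace :: "'a::real_vector sqspace \<Rightarrow> bool" where
  "sqspace X \<longleftrightarrow> subspace (carr X) \<and>
     (\<forall>x\<in>carr X. 0 \<le> sqnorm X x) \<and>
     (\<forall>x\<in>carr X. \<forall>y\<in>carr X. sqnorm X (x + y) \<le> 2 * sqnorm X x + 2 * sqnorm X y) \<and>
     (\<forall>k. \<forall>x\<in>carr X. sqnorm X (k *\<^sub>R x) = k\<^sup>2 * sqnorm X x)"

definition eqv :: "'a::real_vector sqspace \<Rightarrow> 'a \<Rightarrow> 'a \<Rightarrow> bool" where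
  "eqv X x y \<longleftrightarrow> x \<in> carr X \<and> y \<in> carr X \<and> sqnorm X (x - y) = 0"

text \<open>
  Linearity can only be asked for up to \<open>eqv\<close>: the value of a Bochner integral is 0 where the
  integrand is not integrable, so an integral operator on representatives is additive only at almost
  every point.
\<close>
definition bounded_op :: "'a::real_vector sqspace \<Rightarrow> 'b::real_vector sqspace \<Rightarrow> ('a \<Rightarrow> 'b) \<Rightarrow> bool" where
  "bounded_op X Y F \<longleftrightarrow> (\<forall>x\<in>carr X. F x \<in> carr Y) \<and>
     (\<forall>x\<in>carr X. \<forall>y\<in>carr X. eqv Y (F (x + y)) (F x + F y)) \<and>
     (\<forall>k. \<forall>x\<in>carr X. eqv Y (F (k *\<^sub>R x)) (k *\<^sub>R F x)) \<and>
     (\<exists>C\<ge>0. \<forall>x\<in>carr X. sqnorm Y (F x) \<le> C * sqnorm X x)"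

lemma sqspace_closed:
  assumes "sqspace X"
  shows "0 \<in> carr X" "x \<in> carr X \<Longrightarrow> y \<in> carr X \<Longrightarrow> x + y \<in> carr X"
    "x \<in> carr X \<Longrightarrow> y \<in> carr X \<Longrightarrow> x - y \<in> carr X" "x \<in> carr X \<Longrightarrow> k *\<^sub>R x \<in> carr X"
  using assms by (auto simp: sqspace_def subspace_0 subspace_add subspace_diff subspace_scale)

lemma sqspace_sqnorm:
  assumes "sqspace X"
  shows "x \<in> carr X \<Longrightarrow> 0 \<le> sqnorm X x" "sqnorm X 0 = 0"
    "x \<in> carr X \<Longrightarrow> y \<in> carr X \<Longrightarrow> sqnorm X (x + y) \<le> 2 * sqnorm X x + 2 * sqnorm X y"
    "x \<in> carr X \<Longrightarrow> sqnorm X (k *\<^sub>R x) = k\<^sup>2 * sqnorm X x"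
proof -
  have "sqnorm X (0 *\<^sub>R 0) = 0\<^sup>2 * sqnorm X 0"
    using assms sqspace_closed(1)[OF assms] unfolding sqspace_def by blast
  then show "sqnorm X 0 = 0" by simp
qed (use assms in \<open>auto simp: sqspace_def\<close>)

lemma sqnorm_minus_commute:
  assumes "sqspace X" "x \<in> carr X" "y \<in> carr X"
  shows "sqnorm X (x - y) = sqnorm X (y - x)"
  using sqspace_sqnorm(4)[OF assms(1) sqspace_closed(3)[OF assms(1,2,3)], of "-1"] by simp

lemma sqnorm_triangle:
  assumes "sqspace X" "x \<in> carr X" "y \<in> carr X" "z \<in> carr X"
  shows "sqnorm X (x - z) \<le> 2 * sqnorm X (x - y) + 2 * sqnorm X (y - z)"
  using sqspace_sqnorm(3)[OF assms(1), of "x - y" "y - z"] sqspace_closed[OF assms(1)] assms by simp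

lemma eqv_carr: "eqv X x y \<Longrightarrow> x \<in> carr X" "eqv X x y \<Longrightarrow> y \<in> carr X"
  by (auto simp: eqv_def)

lemma eqv_refl: "sqspace X \<Longrightarrow> x \<in> carr X \<Longrightarrow> eqv X x x"
  by (simp add: eqv_def sqspace_sqnorm)

lemma eqv_sym: "sqspace X \<Longrightarrow> eqv X x y \<Longrightarrow> eqv X y x"
  by (auto simp: eqv_def sqnorm_minus_commute)

lemma eqv_trans:
  assumes "sqspace X" "eqv X x y" "eqv X y z"
  shows "eqv X x z"
  using sqnorm_triangle[OF assms(1), of x y z] sqspace_sqnorm(1)[OF assms(1), of "x - z"]
    sqspace_closed(3)[OF assms(1), of x z] assms(2,3)
  by (auto simp: eqv_def)

lemma eqv_cong:
  assumes "sqspace X" "eqv X x x'" "eqv X y y'"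
  shows "eqv X x y \<longleftrightarrow> eqv X x' y'"
  using eqv_trans[OF assms(1)] eqv_sym[OF assms(1)] assms(2,3) by blast

lemma eqv_add:
  assumes "sqspace X" "eqv X x x'" "eqv X y y'"
  shows "eqv X (x + y) (x' + y')"
proof -
  have "sqnorm X ((x - x') + (y - y')) \<le> 2 * sqnorm X (x - x') + 2 * sqnorm X (y - y')"
    using assms by (intro sqspace_sqnorm sqspace_closed) (auto simp: eqv_def)
  moreover have "(x - x') + (y - y') \<in> carr X" "x + y \<in> carr X" "x' + y' \<in> carr X"
    using assms by (auto intro!: sqspace_closed simp: eqv_def)
  ultimately show ?thesis
    using assms sqspace_sqnorm(1)[OF assms(1), of "(x - x') + (y - y')"]
    by (simp add: eqv_def algebra_simps)
qed

lemma eqv_scale: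
  assumes "sqspace X" "eqv X x x'"
  shows "eqv X (k *\<^sub>R x) (k *\<^sub>R x')"
  using assms sqspace_sqnorm(4)[OF assms(1), of "x - x'" k] sqspace_closed[OF assms(1)]
  by (auto simp: eqv_def scaleR_diff_right)

lemma eqv_diff:
  assumes "sqspace X" "eqv X x x'" "eqv X y y'"
  shows "eqv X (x - y) (x' - y')"
  using eqv_add[OF assms(1,2) eqv_scale[OF assms(1,3), of "-1"]] by simp

lemma eqv_sqnorm_le:
  assumes "sqspace X" "eqv X x y"
  shows "sqnorm X x \<le> 2 * sqnorm X y"
  using sqspace_sqnorm(3)[OF assms(1), of "x - y" y] sqspace_closed[OF assms(1)] assms(2)
  by (simp add: eqv_def)

lemma bounded_op_carr: "bounded_op X Y F \<Longrightarrow> x \<in> carr X \<Longrightarrow> F x \<in> carr Y"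
  by (simp add: bounded_op_def)

lemma bounded_op_plus: "bounded_op X Y F \<Longrightarrow> x \<in> carr X \<Longrightarrow> y \<in> carr X \<Longrightarrow> eqv Y (F (x + y)) (F x + F y)"
  by (simp add: bounded_op_def)

lemma bounded_op_scale: "bounded_op X Y F \<Longrightarrow> x \<in> carr X \<Longrightarrow> eqv Y (F (k *\<^sub>R x)) (k *\<^sub>R F x)"
  by (simp add: bounded_op_def)

lemma bounded_op_bound:
  assumes "bounded_op X Y F"
  obtains C where "0 \<le> C" "\<And>x. x \<in> carr X \<Longrightarrow> sqnorm Y (F x) \<le> C * sqnorm X x"
  using assms by (auto simp: bounded_op_def)

lemma bounded_op_diff:
  assumes "sqspace X" "sqspace Y" "bounded_op X Y F" "x \<in> carr X" "y \<in> carr X"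
  shows "eqv Y (F (x - y)) (F x - F y)"
proof -
  have "eqv Y (F (x + (-1) *\<^sub>R y)) (F x + F ((-1) *\<^sub>R y))"
    using assms sqspace_closed(4)[OF assms(1,5), of "-1"] by (intro bounded_op_plus)
  moreover have "eqv Y (F x + F ((-1) *\<^sub>R y)) (F x + (-1) *\<^sub>R F y)"
    using assms by (intro eqv_add bounded_op_scale eqv_refl bounded_op_carr[OF assms(3)])
  ultimately show ?thesis
    using eqv_trans[OF assms(2)] by fastforce
qed

text \<open>
  This is the reason for including a bound in \<open>bounded_op\<close>: boundedness makes an operator that acts
  on representatives descend to the equivalence classes.
\<close>
lemma bounded_op_eqv:
  assumes "sqspace X" "sqspace Y" "bounded_op X Y F" "eqv X x y"
  shows "eqv Y (F x) (F y)"
proof -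
  obtain C where C: "0 \<le> C" "\<And>x. x \<in> carr X \<Longrightarrow> sqnorm Y (F x) \<le> C * sqnorm X x"
    using bounded_op_bound[OF assms(3)] by blast
  have xy: "x \<in> carr X" "y \<in> carr X" "x - y \<in> carr X" "sqnorm X (x - y) = 0"
    using assms sqspace_closed(3)[OF assms(1)] by (auto simp: eqv_def)
  have "sqnorm Y (F (x - y)) \<le> 0"
    using C(2)[OF xy(3)] xy(4) by simp
  moreover have "sqnorm Y (F x - F y) \<le> 2 * sqnorm Y (F (x - y))"
    using eqv_sqnorm_le[OF assms(2) eqv_sym[OF assms(2) bounded_op_diff[OF assms(1-3) xy(1,2)]]] .
  moreover have "F x - F y \<in> carr Y"
    using xy assms by (intro sqspace_closed(3) bounded_op_carr[OF assms(3)])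
  ultimately show ?thesis
    using sqspace_sqnorm(1)[OF assms(2), of "F x - F y"] bounded_op_carr[OF assms(3)] xy
    by (auto simp: eqv_def)
qed

lemma bounded_op_comp:
  assumes "sqspace X" "sqspace Y" "sqspace Z" "bounded_op X Y F" "bounded_op Y Z G"
  shows "bounded_op X Z (\<lambda>x. G (F x))"
proof -
  obtain C where C: "0 \<le> C" "\<And>x. x \<in> carr X \<Longrightarrow> sqnorm Y (F x) \<le> C * sqnorm X x"
    using bounded_op_bound[OF assms(4)] by blast
  obtain D where D: "0 \<le> D" "\<And>x. x \<in> carr Y \<Longrightarrow> sqnorm Z (G x) \<le> D * sqnorm Y x"
    using bounded_op_bound[OF assms(5)] by blast
  have "sqnorm Z (G (F x)) \<le> (D * C) * sqnorm X x" if "x \<in> carr X" for x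
    using D(2)[OF bounded_op_carr[OF assms(4) that]] mult_left_mono[OF C(2)[OF that] D(1)]
    by (simp add: mult.assoc)
  moreover have "eqv Z (G (F (x + y))) (G (F x) + G (F y))" if "x \<in> carr X" "y \<in> carr X" for x y
    by (rule eqv_trans[OF assms(3) bounded_op_eqv[OF assms(2,3,5) bounded_op_plus[OF assms(4) that]]
          bounded_op_plus[OF assms(5) bounded_op_carr[OF assms(4) that(1)] bounded_op_carr[OF assms(4) that(2)]]])
  moreover have "eqv Z (G (F (k *\<^sub>R x))) (k *\<^sub>R G (F x))" if "x \<in> carr X" for x k
    by (rule eqv_trans[OF assms(3) bounded_op_eqv[OF assms(2,3,5) bounded_op_scale[OF assms(4) that]]
          bounded_op_scale[OF assms(5) bounded_op_carr[OF assms(4) that]]])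
  moreover have "0 \<le> D * C" using C(1) D(1) by simp
  moreover have "\<forall>x\<in>carr X. G (F x) \<in> carr Z"
    using bounded_op_carr[OF assms(4)] bounded_op_carr[OF assms(5)] by blast
  ultimately show ?thesis
    unfolding bounded_op_def by blast
qed

text \<open>
  Lets an operator be identified from an expression that represents it only almost everywhere.
\<close>
lemma bounded_op_cong:
  assumes "sqspace X" "sqspace Y" "bounded_op X Y F" "\<And>x. x \<in> carr X \<Longrightarrow> eqv Y (G x) (F x)"
  shows "bounded_op X Y G"
proof -
  note tr = eqv_trans[OF assms(2)] and sy = eqv_sym[OF assms(2)]
  obtain C where C: "0 \<le> C" "\<And>x. x \<in> carr X \<Longrightarrow> sqnorm Y (F x) \<le> C * sqnorm X x"
    using bounded_op_bound[OF assms(3)] by blast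
  have "sqnorm Y (G x) \<le> (2 * C) * sqnorm X x" if "x \<in> carr X" for x
    using eqv_sqnorm_le[OF assms(2) assms(4)[OF that]] C(2)[OF that] by simp
  moreover have "eqv Y (G (x + y)) (G x + G y)" if "x \<in> carr X" "y \<in> carr X" for x y
    using tr[OF tr[OF assms(4) bounded_op_plus[OF assms(3) that]] sy[OF eqv_add[OF assms(2) assms(4) assms(4)]]]
      that sqspace_closed[OF assms(1)] by blast
  moreover have "eqv Y (G (k *\<^sub>R x)) (k *\<^sub>R G x)" if "x \<in> carr X" for x k
    using tr[OF tr[OF assms(4) bounded_op_scale[OF assms(3) that]] sy[OF eqv_scale[OF assms(2) assms(4)]]]
      that sqspace_closed[OF assms(1)] by blast
  moreover have "0 \<le> 2 * C" using C(1) by simp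
  moreover have "\<forall>x\<in>carr X. G x \<in> carr Y"
    using assms(4) by (auto simp: eqv_def)
  ultimately show ?thesis
    unfolding bounded_op_def by blast
qed

lemma bounded_op_add:
  assumes "sqspace X" "sqspace Y" "bounded_op X Y F" "bounded_op X Y G"
  shows "bounded_op X Y (\<lambda>x. F x + G x)"
proof -
  obtain C where C: "0 \<le> C" "\<And>x. x \<in> carr X \<Longrightarrow> sqnorm Y (F x) \<le> C * sqnorm X x"
    using bounded_op_bound[OF assms(3)] by blast
  obtain D where D: "0 \<le> D" "\<And>x. x \<in> carr X \<Longrightarrow> sqnorm Y (G x) \<le> D * sqnorm X x"
    using bounded_op_bound[OF assms(4)] by blast
  have "sqnorm Y (F x + G x) \<le> (2 * C + 2 * D) * sqnorm X x" if "x \<in> carr X" for x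
    using sqspace_sqnorm(3)[OF assms(2) bounded_op_carr[OF assms(3) that] bounded_op_carr[OF assms(4) that]]
      C(2)[OF that] D(2)[OF that] by (simp add: algebra_simps)
  moreover have "eqv Y (F (x + y) + G (x + y)) (F x + G x + (F y + G y))"
    if "x \<in> carr X" "y \<in> carr X" for x y
    using eqv_add[OF assms(2) bounded_op_plus[OF assms(3) that] bounded_op_plus[OF assms(4) that]]
    by (simp add: algebra_simps)
  moreover have "eqv Y (F (k *\<^sub>R x) + G (k *\<^sub>R x)) (k *\<^sub>R (F x + G x))" if "x \<in> carr X" for x k
    using eqv_add[OF assms(2) bounded_op_scale[OF assms(3) that] bounded_op_scale[OF assms(4) that]]
    by (simp add: scaleR_add_right)
  moreover have "0 \<le> 2 * C + 2 * D" using C(1) D(1) by simp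
  moreover have "\<forall>x\<in>carr X. F x + G x \<in> carr Y"
    using sqspace_closed(2)[OF assms(2)] bounded_op_carr[OF assms(3)] bounded_op_carr[OF assms(4)] by blast
  ultimately show ?thesis
    unfolding bounded_op_def by blast
qed

lemma bounded_op_zero: "sqspace X \<Longrightarrow> sqspace Y \<Longrightarrow> bounded_op X Y (\<lambda>x. 0)"
  by (auto simp: bounded_op_def eqv_def sqspace_closed sqspace_sqnorm intro!: exI[of _ 0])

lemma bounded_op_sum:
  assumes "sqspace X" "sqspace Y" "\<And>j. j < (n::nat) \<Longrightarrow> bounded_op X Y (F j)"
  shows "bounded_op X Y (\<lambda>x. \<Sum>j<n. F j x)"
  using assms(3) by (induction n) (auto intro!: bounded_op_add bounded_op_zero assms(1,2))

section \<open>Derivatives of curves\<close>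

text \<open>
  The limit is that of the square of the difference quotient in \<open>zderiv\<close>, which vanishes under the
  same conditions.
\<close>
definition sqderiv :: "'a::real_vector sqspace \<Rightarrow> (real \<Rightarrow> 'a) \<Rightarrow> 'a \<Rightarrow> real \<Rightarrow> bool" where
  "sqderiv X x x' t \<longleftrightarrow> x' \<in> carr X \<and>
     ((\<lambda>s. sqnorm X (x s - x t - (s - t) *\<^sub>R x') / (s - t)\<^sup>2) \<longlongrightarrow> 0) (at t within {0..})"

lemma sqderiv_carr: "sqderiv X x x' t \<Longrightarrow> x' \<in> carr X"
  by (simp add: sqderiv_def)

lemma eventually_nonneg_neq: "eventually (\<lambda>s. 0 \<le> s \<and> s \<noteq> t) (at t within {0::real..})"
  by (auto simp: eventually_at_filter)

lemma tendsto_0_linear_combination: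
  fixes f g :: "real \<Rightarrow> real"
  assumes "((\<lambda>s. f s / (s - t)\<^sup>2) \<longlongrightarrow> 0) F" "((\<lambda>s. g s / (s - t)\<^sup>2) \<longlongrightarrow> 0) F"
  shows "((\<lambda>s. (\<alpha> * f s + \<beta> * g s) / (s - t)\<^sup>2) \<longlongrightarrow> 0) F"
proof -
  have "((\<lambda>s. \<alpha> * (f s / (s - t)\<^sup>2) + \<beta> * (g s / (s - t)\<^sup>2)) \<longlongrightarrow> \<alpha> * 0 + \<beta> * 0) F"
    by (intro tendsto_intros assms)
  then show ?thesis by (simp add: add_divide_distrib)
qed

text \<open>
  All the rules for derivatives follow by bounding the remainder of a curve by remainders that are
  already known to be small.
\<close>
lemma sqderiv_dominated:
  assumes "y' \<in> carr Y" "sqspace Y" "0 \<le> t"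
    and "\<And>s. 0 \<le> s \<Longrightarrow> y s \<in> carr Y"
    and "((\<lambda>s. B s / (s - t)\<^sup>2) \<longlongrightarrow> 0) (at t within {0..})"
    and "\<And>s. 0 \<le> s \<Longrightarrow> sqnorm Y (y s - y t - (s - t) *\<^sub>R y') \<le> B s"
  shows "sqderiv Y y y' t"
  unfolding sqderiv_def
proof (intro conjI assms(1) tendsto_sandwich[OF _ _ tendsto_const assms(5)])
  show "\<forall>\<^sub>F s in at t within {0..}. 0 \<le> sqnorm Y (y s - y t - (s - t) *\<^sub>R y') / (s - t)\<^sup>2"
    using eventually_nonneg_neq
    by eventually_elim (use assms in \<open>auto intro!: divide_nonneg_nonneg sqspace_sqnorm sqspace_closed\<close>)
  show "\<forall>\<^sub>F s in at t within {0..}. sqnorm Y (y s - y t - (s - t) *\<^sub>R y') / (s - t)\<^sup>2 \<le> B s / (s - t)\<^sup>2"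
    using eventually_nonneg_neq
    by eventually_elim (use assms in \<open>auto intro!: divide_right_mono\<close>)
qed

lemma sqderiv_add:
  assumes "sqspace X" "sqderiv X x x' t" "sqderiv X y y' t" "0 \<le> t"
    and "\<And>s. 0 \<le> s \<Longrightarrow> x s \<in> carr X" "\<And>s. 0 \<le> s \<Longrightarrow> y s \<in> carr X"
  shows "sqderiv X (\<lambda>s. x s + y s) (x' + y') t"
proof (rule sqderiv_dominated)
  let ?u = "\<lambda>s. x s - x t - (s - t) *\<^sub>R x'" and ?v = "\<lambda>s. y s - y t - (s - t) *\<^sub>R y'"
  show "((\<lambda>s. (2 * sqnorm X (?u s) + 2 * sqnorm X (?v s)) / (s - t)\<^sup>2) \<longlongrightarrow> 0) (at t within {0..})"
    using tendsto_0_linear_combination[of "\<lambda>s. sqnorm X (?u s)" t "at t within {0..}" "\<lambda>s. sqnorm X (?v s)" 2 2] assms(2,3) by (simp add: sqderiv_def)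
  fix s :: real assume s: "0 \<le> s"
  have "sqnorm X (?u s + ?v s) \<le> 2 * sqnorm X (?u s) + 2 * sqnorm X (?v s)"
    using assms s by (intro sqspace_sqnorm sqspace_closed) (auto simp: sqderiv_def)
  then show "sqnorm X (x s + y s - (x t + y t) - (s - t) *\<^sub>R (x' + y'))
      \<le> 2 * sqnorm X (?u s) + 2 * sqnorm X (?v s)"
    by (simp add: algebra_simps)
qed (use assms in \<open>auto intro!: sqspace_closed simp: sqderiv_def\<close>)

text \<open>
  A bounded linear map takes the remainder of \<open>x\<close> to that of its image, up to \<open>eqv\<close>; the
  bound then keeps it small.
\<close>
lemma sqderiv_bounded_op:
  assumes "sqspace X" "sqspace Y" "bounded_op X Y F" "sqderiv X x x' t" "0 \<le> t"
    and x: "\<And>s. 0 \<le> s \<Longrightarrow> x s \<in> carr X"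
  shows "sqderiv Y (\<lambda>s. F (x s)) (F x') t"
proof -
  obtain C where C: "0 \<le> C" "\<And>x. x \<in> carr X \<Longrightarrow> sqnorm Y (F x) \<le> C * sqnorm X x"
    using bounded_op_bound[OF assms(3)] by blast
  have x': "x' \<in> carr X" using assms(4) by (simp add: sqderiv_def)
  let ?u = "\<lambda>s. x s - x t - (s - t) *\<^sub>R x'"
  show ?thesis
  proof (rule sqderiv_dominated)
    show "((\<lambda>s. (2 * C * sqnorm X (?u s)) / (s - t)\<^sup>2) \<longlongrightarrow> 0) (at t within {0..})"
      using tendsto_0_linear_combination[of "\<lambda>s. sqnorm X (?u s)" t "at t within {0..}" "\<lambda>_. 0" "2 * C" 0] assms(4)
      by (simp add: sqderiv_def)
    fix s :: real assume s: "0 \<le> s"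
    have u: "?u s \<in> carr X" "x s - x t \<in> carr X" "(s - t) *\<^sub>R x' \<in> carr X"
      using assms s x' by (auto intro!: sqspace_closed)
    have "eqv Y (F (?u s)) (F (x s - x t) - F ((s - t) *\<^sub>R x'))"
      using u assms by (intro bounded_op_diff)
    also have "eqv Y (F (x s - x t) - F ((s - t) *\<^sub>R x')) (F (x s) - F (x t) - (s - t) *\<^sub>R F x')"
      using assms s x' by (intro eqv_diff bounded_op_diff bounded_op_scale) auto
    finally (eqv_trans[OF assms(2)])
    have "sqnorm Y (F (x s) - F (x t) - (s - t) *\<^sub>R F x') \<le> 2 * sqnorm Y (F (?u s))"
      by (rule eqv_sqnorm_le[OF assms(2) eqv_sym[OF assms(2)]])
    then show "sqnorm Y (F (x s) - F (x t) - (s - t) *\<^sub>R F x') \<le> 2 * C * sqnorm X (?u s)"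
      using C(2)[OF u(1)] by simp
  qed (use assms x' in \<open>auto intro!: bounded_op_carr[OF assms(3)]\<close>)
qed

lemma sqderiv_cong:
  assumes "sqspace X" "sqderiv X x x' t" "0 \<le> t" "\<And>s. 0 \<le> s \<Longrightarrow> eqv X (y s) (x s)"
  shows "sqderiv X y x' t"
proof (rule sqderiv_dominated)
  let ?u = "\<lambda>s. x s - x t - (s - t) *\<^sub>R x'"
  have x': "x' \<in> carr X" using assms(2) by (simp add: sqderiv_def)
  show "((\<lambda>s. (2 * sqnorm X (?u s)) / (s - t)\<^sup>2) \<longlongrightarrow> 0) (at t within {0..})"
    using tendsto_0_linear_combination[of "\<lambda>s. sqnorm X (?u s)" t "at t within {0..}" "\<lambda>_. 0" 2 0] assms(2)
    by (simp add: sqderiv_def)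
  fix s :: real assume s: "0 \<le> s"
  show "sqnorm X (y s - y t - (s - t) *\<^sub>R x') \<le> 2 * sqnorm X (?u s)"
    using assms s x'
    by (intro eqv_sqnorm_le eqv_diff eqv_refl sqspace_closed) auto
qed (use assms in \<open>auto simp: sqderiv_def eqv_def\<close>)

text \<open>
  The difference of two derivatives, multiplied by \<open>s - t\<close>, is the difference of two remainders; as
  its squared seminorm is \<open>(s - t)\<^sup>2\<close> times a constant, that constant is 0.  That \<open>t\<close> is a limit point
  of the half line is essential.
\<close>
lemma sqderiv_unique:
  assumes "sqspace X" "sqderiv X x x' t" "sqderiv X x x'' t" "0 \<le> t"
    and x: "\<And>s. 0 \<le> s \<Longrightarrow> x s \<in> carr X"
  shows "eqv X x' x''"
proof -
  have x': "x' \<in> carr X" "x'' \<in> carr X" using assms(2,3) by (simp_all add: sqderiv_def)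
  let ?u = "\<lambda>s. x s - x t - (s - t) *\<^sub>R x'" and ?v = "\<lambda>s. x s - x t - (s - t) *\<^sub>R x''"
  have lim: "((\<lambda>s. (2 * sqnorm X (?u s) + 2 * sqnorm X (?v s)) / (s - t)\<^sup>2) \<longlongrightarrow> 0) (at t within {0..})"
    using tendsto_0_linear_combination[of "\<lambda>s. sqnorm X (?u s)" t "at t within {0..}" "\<lambda>s. sqnorm X (?v s)" 2 2] assms(2,3) by (simp add: sqderiv_def)
  have ev: "\<forall>\<^sub>F s in at t within {0..}.
      sqnorm X (x' - x'') \<le> (2 * sqnorm X (?u s) + 2 * sqnorm X (?v s)) / (s - t)\<^sup>2"
    using eventually_nonneg_neq
  proof eventually_elim
    fix s :: real assume s: "0 \<le> s \<and> s \<noteq> t"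
    have uv: "?u s \<in> carr X" "?v s \<in> carr X"
      using assms s x' by (auto intro!: sqspace_closed)
    have "sqnorm X (?v s - ?u s) \<le> 2 * sqnorm X (?v s) + 2 * sqnorm X (?u s)"
      using sqnorm_triangle[OF assms(1) uv(2) sqspace_closed(1)[OF assms(1)] uv(1)]
        sqnorm_minus_commute[OF assms(1) uv(1) sqspace_closed(1)[OF assms(1)]] by simp
    also have "?v s - ?u s = (s - t) *\<^sub>R (x' - x'')"
      by (simp add: algebra_simps)
    also have "sqnorm X \<dots> = (s - t)\<^sup>2 * sqnorm X (x' - x'')"
      using assms x' by (intro sqspace_sqnorm sqspace_closed)
    finally show "sqnorm X (x' - x'') \<le> (2 * sqnorm X (?u s) + 2 * sqnorm X (?v s)) / (s - t)\<^sup>2"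
      using s by (simp add: field_simps)
  qed
  have "at t within {0..} \<noteq> bot"
    using at_le[of "{t<..}" "{0..}" t] \<open>0 \<le> t\<close> trivial_limit_at_right_real[of t]
    by (auto simp: bot_unique subset_eq)
  then have "sqnorm X (x' - x'') \<le> 0"
    by (intro tendsto_lowerbound[OF lim ev]) 
  then show ?thesis
    using sqspace_sqnorm(1)[OF assms(1) sqspace_closed(3)[OF assms(1) x']] x' by (simp add: eqv_def)
qed

section \<open>Square integrable functions and vectors of them\<close>

lemma ennreal_square_abs: "ennreal (x\<^sup>2) = (ennreal \<bar>x\<bar>)\<^sup>2"
  by (simp add: ennreal_power)

lemma L2_iff: "f \<in> L2 M \<longleftrightarrow> f \<in> borel_measurable M \<and> (\<integral>\<^sup>+x. ennreal ((f x)\<^sup>2) \<partial>M) < \<infinity>"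
  by (auto simp: L2_def integrable_iff_bounded)

lemma L2_measurable: "f \<in> L2 M \<Longrightarrow> f \<in> borel_measurable M"
  by (simp add: L2_def)

lemma L2_nn_integral: "f \<in> L2 M \<Longrightarrow> (\<integral>\<^sup>+x. ennreal ((f x)\<^sup>2) \<partial>M) = ennreal (LINT x|M. (f x)\<^sup>2)"
  by (auto simp: L2_def intro!: nn_integral_eq_integral)

lemma power2_sum_le: "(x + y)\<^sup>2 \<le> 2 * x\<^sup>2 + 2 * (y::real)\<^sup>2"
  using sum_squares_ge_zero[of "x - y" 0] by (simp add: power2_eq_square algebra_simps)

lemma L2_bound:
  assumes "f \<in> borel_measurable M" "(\<integral>\<^sup>+x. ennreal ((f x)\<^sup>2) \<partial>M) \<le> ennreal C" "0 \<le> C"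
  shows "f \<in> L2 M" "(LINT x|M. (f x)\<^sup>2) \<le> C"
proof -
  show f: "f \<in> L2 M"
    using assms by (auto simp: L2_iff intro: le_less_trans)
  show "(LINT x|M. (f x)\<^sup>2) \<le> C"
    using assms by (simp add: L2_nn_integral[OF f])
qed

lemma L2_add:
  assumes "f \<in> L2 M" "g \<in> L2 M"
  shows "(\<lambda>x. f x + g x) \<in> L2 M"
    and "(LINT x|M. (f x + g x)\<^sup>2) \<le> 2 * (LINT x|M. (f x)\<^sup>2) + 2 * (LINT x|M. (g x)\<^sup>2)"
proof -
  have [measurable]: "f \<in> borel_measurable M" "g \<in> borel_measurable M"
    using assms by (simp_all add: L2_def)
  have i: "integrable M (\<lambda>x. 2 * (f x)\<^sup>2 + 2 * (g x)\<^sup>2)"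
    using assms by (simp add: L2_def)
  have i2: "integrable M (\<lambda>x. (f x + g x)\<^sup>2)"
    using power2_sum_le by (intro Bochner_Integration.integrable_bound[OF i]) auto
  then show "(\<lambda>x. f x + g x) \<in> L2 M"
    by (simp add: L2_def)
  have "(LINT x|M. (f x + g x)\<^sup>2) \<le> (LINT x|M. 2 * (f x)\<^sup>2 + 2 * (g x)\<^sup>2)"
    by (intro integral_mono i i2 power2_sum_le)
  also have "\<dots> = 2 * (LINT x|M. (f x)\<^sup>2) + 2 * (LINT x|M. (g x)\<^sup>2)"
    using assms by (simp add: L2_def)
  finally show "(LINT x|M. (f x + g x)\<^sup>2) \<le> 2 * (LINT x|M. (f x)\<^sup>2) + 2 * (LINT x|M. (g x)\<^sup>2)" .
qed

lemma L2_scale: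
  assumes "f \<in> L2 M"
  shows "(\<lambda>x. k * f x) \<in> L2 M" "(LINT x|M. (k * f x)\<^sup>2) = k\<^sup>2 * (LINT x|M. (f x)\<^sup>2)"
  using assms by (auto simp: L2_def power_mult_distrib)

lemma L2_zero: "(\<lambda>x. 0) \<in> L2 M"
  by (simp add: L2_def)

lemma L2_diff: "f \<in> L2 M \<Longrightarrow> g \<in> L2 M \<Longrightarrow> (\<lambda>x. f x - g x) \<in> L2 M"
  using L2_add(1)[OF _ L2_scale(1)[of g M "-1"], of f] by simp

definition L2space :: "'a measure \<Rightarrow> ('a \<Rightarrow> real) sqspace" where
  "L2space M = (L2 M, \<lambda>f. LINT x|M. (f x)\<^sup>2)"

lemma sqspace_L2space: "sqspace (L2space M)"
  unfolding sqspace_def L2space_def carr_sqnorm_Pair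
proof (intro conjI ballI allI)
  show "subspace (L2 M)"
    unfolding subspace_def by (auto simp: plus_fun_def scaleR_fun_def zero_fun_def L2_zero L2_add L2_scale)
qed (auto simp: plus_fun_def scaleR_fun_def L2_add L2_scale)

lemma eqv_L2space_iff:
  "eqv (L2space M) f g \<longleftrightarrow> f \<in> L2 M \<and> g \<in> L2 M \<and> (AE x in M. f x = g x)"
proof -
  have "(LINT x|M. (f x - g x)\<^sup>2) = 0 \<longleftrightarrow> (AE x in M. f x = g x)" if "f \<in> L2 M" "g \<in> L2 M"
    using integral_nonneg_eq_0_iff_AE[of M "\<lambda>x. (f x - g x)\<^sup>2"] L2_diff[OF that] by (simp add: L2_def)
  then show ?thesis
    by (auto simp: eqv_def L2space_def)
qed

lemma L2_AE_cong:
  assumes "g \<in> L2 M" "f \<in> borel_measurable M" "AE x in M. f x = g x"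
  shows "f \<in> L2 M"
proof -
  have [measurable]: "g \<in> borel_measurable M" using assms by (simp add: L2_def)
  have "(\<integral>\<^sup>+x. ennreal ((f x)\<^sup>2) \<partial>M) = (\<integral>\<^sup>+x. ennreal ((g x)\<^sup>2) \<partial>M)"
    using assms(3) by (intro nn_integral_cong_AE) auto
  then show ?thesis using assms by (simp add: L2_iff)
qed

definition L2vec :: "nat \<Rightarrow> 'a measure \<Rightarrow> ('a \<Rightarrow> vec) sqspace" where
  "L2vec n M = ({f. \<forall>i<n. (\<lambda>x. f x i) \<in> L2 M}, \<lambda>f. \<Sum>i<n. LINT x|M. (f x i)\<^sup>2)"

lemma sqspace_L2vec: "sqspace (L2vec n M)"
  unfolding sqspace_def L2vec_def carr_sqnorm_Pair
proof (intro conjI ballI allI)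
  fix f g assume *: "f \<in> {f. \<forall>i<n. (\<lambda>x. f x i) \<in> L2 M}" "g \<in> {f. \<forall>i<n. (\<lambda>x. f x i) \<in> L2 M}"
  show "(\<Sum>i<n. LINT x|M. ((f + g) x i)\<^sup>2)
    \<le> 2 * (\<Sum>i<n. LINT x|M. (f x i)\<^sup>2) + 2 * (\<Sum>i<n. LINT x|M. (g x i)\<^sup>2)"
    using * unfolding sum_distrib_left sum.distrib[symmetric]
    by (intro sum_mono) (auto intro!: L2_add)
qed (auto simp: subspace_def scaleR_fun_def L2_zero L2_add L2_scale sum_distrib_left intro!: sum_nonneg)

lemma carr_L2vec: "f \<in> carr (L2vec n M) \<longleftrightarrow> (\<forall>i<n. (\<lambda>x. f x i) \<in> L2 M)"
  by (simp add: L2vec_def)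

lemma sqnorm_L2vec: "sqnorm (L2vec n M) f = (\<Sum>i<n. LINT x|M. (f x i)\<^sup>2)"
  by (simp add: L2vec_def)

lemma eqv_L2vec_iff_L2space:
  "eqv (L2vec n M) f g \<longleftrightarrow> (\<forall>i<n. eqv (L2space M) (\<lambda>x. f x i) (\<lambda>x. g x i))"
  by (auto simp: eqv_def L2vec_def L2space_def sum_nonneg_eq_0_iff)

lemma eqv_L2vec_iff:
  "eqv (L2vec n M) f g \<longleftrightarrow> f \<in> carr (L2vec n M) \<and> g \<in> carr (L2vec n M) \<and> (\<forall>i<n. AE x in M. f x i = g x i)"
  by (auto simp: eqv_L2vec_iff_L2space eqv_L2space_iff carr_L2vec)

lemma bounded_op_L2vec_component: "i < n \<Longrightarrow> bounded_op (L2vec n M) (L2space M) (\<lambda>f x. f x i)"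
  unfolding bounded_op_def eqv_L2space_iff
  by (auto simp: L2space_def L2vec_def L2_add L2_scale scaleR_fun_def plus_fun_def
      intro!: exI[of _ 1] member_le_sum[of i "{..<n}"])

lemma bounded_op_L2vecI:
  assumes "sqspace X" "\<And>i. i < n \<Longrightarrow> bounded_op X (L2space M) (\<lambda>u x. F u x i)"
  shows "bounded_op X (L2vec n M) F"
proof -
  have "\<exists>C. \<forall>i<n. 0 \<le> C i \<and> (\<forall>u\<in>carr X. (LINT x|M. (F u x i)\<^sup>2) \<le> C i * sqnorm X u)"
    using assms(2) unfolding bounded_op_def L2space_def carr_sqnorm_Pair by metis
  then obtain C where C: "\<And>i. i < n \<Longrightarrow> 0 \<le> C i"
    "\<And>i u. i < n \<Longrightarrow> u \<in> carr X \<Longrightarrow> (LINT x|M. (F u x i)\<^sup>2) \<le> C i * sqnorm X u"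
    by blast
  have "sqnorm (L2vec n M) (F u) \<le> (\<Sum>i<n. C i) * sqnorm X u" if "u \<in> carr X" for u
    using C that by (auto simp: sqnorm_L2vec sum_distrib_right intro!: sum_mono)
  moreover have "0 \<le> (\<Sum>i<n. C i)" using C by (auto intro!: sum_nonneg)
  moreover have "F u \<in> carr (L2vec n M)" if "u \<in> carr X" for u
    using bounded_op_carr[OF assms(2) that] by (simp add: carr_L2vec L2space_def)
  moreover have "eqv (L2vec n M) (F (u + v)) (F u + F v)" if "u \<in> carr X" "v \<in> carr X" for u v
    using bounded_op_plus[OF assms(2) that] by (simp add: eqv_L2vec_iff_L2space plus_fun_def)
  moreover have "eqv (L2vec n M) (F (k *\<^sub>R u)) (k *\<^sub>R F u)" if "u \<in> carr X" for u k
    using bounded_op_scale[OF assms(2) that] by (simp add: eqv_L2vec_iff_L2space scaleR_fun_def)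
  ultimately show ?thesis
    unfolding bounded_op_def by blast
qed

section \<open>Pointwise and integral operators\<close>

text \<open>
  A vector of functions whose entries agree almost everywhere with sums of scalar operators need not
  be such a sum at every point.  This occurs for integrals of finite sums, which split only where
  every summand is integrable; measurability is therefore a separate premise.
\<close>
lemma bounded_op_matrix:
  assumes h: "\<And>i j. i < m \<Longrightarrow> j < n \<Longrightarrow> bounded_op (L2space S) (L2space T) (h i j)"
    and meas: "\<And>u i. u \<in> carr (L2vec n S) \<Longrightarrow> i < m \<Longrightarrow> (\<lambda>t. F u t i) \<in> borel_measurable T"
    and ae: "\<And>u i. u \<in> carr (L2vec n S) \<Longrightarrow> i < m \<Longrightarrow> AE t in T. F u t i = (\<Sum>j<n. h i j (\<lambda>s. u s j) t)"
  shows "bounded_op (L2vec n S) (L2vec m T) F"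
proof (intro bounded_op_L2vecI sqspace_L2vec)
  fix i assume i: "i < m"
  have *: "bounded_op (L2vec n S) (L2space T) (\<lambda>u. \<Sum>j<n. h i j (\<lambda>s. u s j))"
    by (intro bounded_op_sum sqspace_L2vec sqspace_L2space
        bounded_op_comp[OF sqspace_L2vec sqspace_L2space sqspace_L2space bounded_op_L2vec_component h] i)
  show "bounded_op (L2vec n S) (L2space T) (\<lambda>u t. F u t i)"
  proof (rule bounded_op_cong[OF sqspace_L2vec sqspace_L2space *])
    fix u assume u: "u \<in> carr (L2vec n S)"
    have eq: "(\<Sum>j<n. h i j (\<lambda>s. u s j)) = (\<lambda>t. \<Sum>j<n. h i j (\<lambda>s. u s j) t)"
      by (induction n) (auto simp: zero_fun_def plus_fun_def)
    have "(\<lambda>t. \<Sum>j<n. h i j (\<lambda>s. u s j) t) \<in> L2 T"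
      using bounded_op_carr[OF * u] unfolding eq by (simp add: L2space_def)
    then show "eqv (L2space T) (\<lambda>t. F u t i) (\<Sum>j<n. h i j (\<lambda>s. u s j))"
      unfolding eq using L2_AE_cong[OF _ meas[OF u i] ae[OF u i]] ae[OF u i]
      by (simp add: eqv_L2space_iff)
  qed
qed

lemma bounded_op_L2spaceI:
  assumes meas: "\<And>g. g \<in> L2 S \<Longrightarrow> h g \<in> borel_measurable T"
    and bound: "\<And>g. g \<in> L2 S \<Longrightarrow>
       (\<integral>\<^sup>+t. ennreal ((h g t)\<^sup>2) \<partial>T) \<le> ennreal C * (\<integral>\<^sup>+s. ennreal ((g s)\<^sup>2) \<partial>S)" and C: "0 \<le> C"
    and add: "\<And>f g. f \<in> L2 S \<Longrightarrow> g \<in> L2 S \<Longrightarrow> AE t in T. h (\<lambda>s. f s + g s) t = h f t + h g t"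
    and scale: "\<And>k g. g \<in> L2 S \<Longrightarrow> AE t in T. h (\<lambda>s. k * g s) t = k * h g t"
  shows "bounded_op (L2space S) (L2space T) h"
proof -
  have b: "h g \<in> L2 T \<and> (LINT t|T. (h g t)\<^sup>2) \<le> C * (LINT s|S. (g s)\<^sup>2)" if "g \<in> L2 S" for g
    using L2_bound[of "h g" T "C * (LINT s|S. (g s)\<^sup>2)"] meas[OF that] bound[OF that] C
    by (simp add: L2_nn_integral[OF that] ennreal_mult)
  show ?thesis
    unfolding bounded_op_def eqv_L2space_iff
    using b C add scale
    by (auto simp: L2space_def plus_fun_def scaleR_fun_def L2_add L2_scale intro!: exI[of _ C])
qed

text \<open>
  Multiplication by \<open>k\<close> composed with a change of variables \<open>\<phi>\<close>.  The premise on \<open>G\<close> says that the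
  weighted image of the measure of \<open>T\<close> under \<open>\<phi>\<close> is at most \<open>C\<close> times that of \<open>S\<close>.  For a projection
  of a product it is Fubini's theorem; stated in this form it covers multipliers, extension by
  constants and tensor products with a fixed function at once.
\<close>
lemma bounded_op_pointwise:
  assumes [measurable]: "\<phi> \<in> measurable T S" "k \<in> borel_measurable T"
    and C: "0 \<le> C" "\<forall>G\<in>borel_measurable S.
       (\<integral>\<^sup>+t. ennreal ((k t)\<^sup>2) * G (\<phi> t) \<partial>T) \<le> ennreal C * (\<integral>\<^sup>+s. G s \<partial>S)"
  shows "bounded_op (L2space S) (L2space T) (\<lambda>g t. k t * g (\<phi> t))"
proof (rule bounded_op_L2spaceI[OF _ _ C(1)])
  fix g assume "g \<in> L2 S"
  then have [measurable]: "g \<in> borel_measurable S" by (rule L2_measurable)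
  show "(\<lambda>t. k t * g (\<phi> t)) \<in> borel_measurable T" by measurable
  show "(\<integral>\<^sup>+t. ennreal ((k t * g (\<phi> t))\<^sup>2) \<partial>T) \<le> ennreal C * (\<integral>\<^sup>+s. ennreal ((g s)\<^sup>2) \<partial>S)"
    using bspec[OF C(2), of "\<lambda>s. ennreal ((g s)\<^sup>2)"] by (simp add: power_mult_distrib ennreal_mult)
qed (auto simp: algebra_simps)

text \<open>
  By the Cauchy-Schwarz inequality in \<open>\<theta>\<close>, the square of the integral of the modulus is at most the
  product of \<open>\<integral>k\<^sup>2\<close> and \<open>\<integral>g\<^sup>2\<close>, and the premise on \<open>G\<close>, used for \<open>G = g\<^sup>2\<close>, bounds the integral of this
  product over \<open>T\<close>.  The product is hence finite at almost every \<open>t\<close>, which gives integrability there.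
  The map \<open>\<phi>\<close> selects which variables of the argument are integrated and which are carried along as
  parameters, so that partial integrals in either variable, total integrals and Hilbert-Schmidt
  operators with parameters are all instances.
\<close>
lemma integral_operator_AE:
  assumes "sigma_finite_measure B"
    and [measurable]: "\<phi> \<in> measurable (T \<Otimes>\<^sub>M B) S" "k \<in> borel_measurable (T \<Otimes>\<^sub>M B)"
    and C: "0 \<le> C" "\<forall>G\<in>borel_measurable S.
       (\<integral>\<^sup>+t. (\<integral>\<^sup>+\<theta>. ennreal ((k (t, \<theta>))\<^sup>2) \<partial>B) * (\<integral>\<^sup>+\<theta>. G (\<phi> (t, \<theta>)) \<partial>B) \<partial>T)
         \<le> ennreal C * (\<integral>\<^sup>+s. G s \<partial>S)"
    and g: "g \<in> L2 S"
  shows "(\<lambda>t. LINT \<theta>|B. k (t, \<theta>) * g (\<phi> (t, \<theta>))) \<in> borel_measurable T"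
    and "AE t in T. integrable B (\<lambda>\<theta>. k (t, \<theta>) * g (\<phi> (t, \<theta>)))"
    and "(\<integral>\<^sup>+t. ennreal ((LINT \<theta>|B. k (t, \<theta>) * g (\<phi> (t, \<theta>)))\<^sup>2) \<partial>T)
           \<le> ennreal C * (\<integral>\<^sup>+s. ennreal ((g s)\<^sup>2) \<partial>S)"
proof -
  interpret B: sigma_finite_measure B by fact
  have [measurable]: "g \<in> borel_measurable S" using g by (rule L2_measurable)
  show [measurable]: "(\<lambda>t. LINT \<theta>|B. k (t, \<theta>) * g (\<phi> (t, \<theta>))) \<in> borel_measurable T"
    by measurable
  let ?I = "\<lambda>t. \<integral>\<^sup>+\<theta>. ennreal \<bar>k (t, \<theta>) * g (\<phi> (t, \<theta>))\<bar> \<partial>B"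
  let ?J = "\<lambda>t. (\<integral>\<^sup>+\<theta>. ennreal ((k (t, \<theta>))\<^sup>2) \<partial>B) * (\<integral>\<^sup>+\<theta>. ennreal ((g (\<phi> (t, \<theta>)))\<^sup>2) \<partial>B)"
  have CS: "(?I t)\<^sup>2 \<le> ?J t" if t: "t \<in> space T" for t
  proof -
    have [measurable]: "(\<lambda>\<theta>. k (t, \<theta>)) \<in> borel_measurable B" "(\<lambda>\<theta>. \<phi> (t, \<theta>)) \<in> measurable B S"
      using t by measurable
    show ?thesis
      using Cauchy_Schwarz_nn_integral[of "\<lambda>\<theta>. ennreal \<bar>k (t, \<theta>)\<bar>" B "\<lambda>\<theta>. ennreal \<bar>g (\<phi> (t, \<theta>))\<bar>"]
      by (simp add: abs_mult ennreal_mult ennreal_square_abs)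
  qed
  have bound: "(\<integral>\<^sup>+t. ?J t \<partial>T) \<le> ennreal C * (\<integral>\<^sup>+s. ennreal ((g s)\<^sup>2) \<partial>S)"
    by (intro bspec[OF C(2), of "\<lambda>s. ennreal ((g s)\<^sup>2)"]) measurable
  also have "\<dots> < \<infinity>"
    using g by (simp add: L2_iff ennreal_mult_less_top)
  finally have "AE t in T. ?J t \<noteq> \<infinity>"
    by (intro nn_integral_PInf_AE) auto
  then show int: "AE t in T. integrable B (\<lambda>\<theta>. k (t, \<theta>) * g (\<phi> (t, \<theta>)))"
    using AE_space
  proof eventually_elim
    fix t assume J: "?J t \<noteq> \<infinity>" and t: "t \<in> space T"
    have [measurable]: "(\<lambda>\<theta>. k (t, \<theta>)) \<in> borel_measurable B" "(\<lambda>\<theta>. \<phi> (t, \<theta>)) \<in> measurable B S"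
      using t by measurable
    have "(?I t)\<^sup>2 < \<infinity>"
      using CS[OF t] J by (simp add: top.not_eq_extremum le_less_trans)
    then have "?I t < \<infinity>"
      by (simp add: power_less_top_ennreal)
    then show "integrable B (\<lambda>\<theta>. k (t, \<theta>) * g (\<phi> (t, \<theta>)))"
      by (simp add: integrable_iff_bounded)
  qed
  have "ennreal ((LINT \<theta>|B. k (t, \<theta>) * g (\<phi> (t, \<theta>)))\<^sup>2) \<le> ?J t" if t: "t \<in> space T" for t
  proof -
    have "ennreal ((LINT \<theta>|B. k (t, \<theta>) * g (\<phi> (t, \<theta>)))\<^sup>2) \<le> (?I t)\<^sup>2"
      using integral_norm_bound_ennreal[of B "\<lambda>\<theta>. k (t, \<theta>) * g (\<phi> (t, \<theta>))"]
      by (cases "integrable B (\<lambda>\<theta>. k (t, \<theta>) * g (\<phi> (t, \<theta>)))")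
        (auto simp: ennreal_square_abs not_integrable_integral_eq intro!: power_mono)
    then show ?thesis using CS[OF t] by (rule order_trans)
  qed
  then have "(\<integral>\<^sup>+t. ennreal ((LINT \<theta>|B. k (t, \<theta>) * g (\<phi> (t, \<theta>)))\<^sup>2) \<partial>T) \<le> (\<integral>\<^sup>+t. ?J t \<partial>T)"
    by (rule nn_integral_mono)
  then show "(\<integral>\<^sup>+t. ennreal ((LINT \<theta>|B. k (t, \<theta>) * g (\<phi> (t, \<theta>)))\<^sup>2) \<partial>T)
           \<le> ennreal C * (\<integral>\<^sup>+s. ennreal ((g s)\<^sup>2) \<partial>S)"
    using bound by (rule order_trans)
qed

lemma bounded_op_integral_operator:
  assumes "sigma_finite_measure B"
    and "\<phi> \<in> measurable (T \<Otimes>\<^sub>M B) S" "k \<in> borel_measurable (T \<Otimes>\<^sub>M B)"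
    and "0 \<le> C" "\<forall>G\<in>borel_measurable S.
       (\<integral>\<^sup>+t. (\<integral>\<^sup>+\<theta>. ennreal ((k (t, \<theta>))\<^sup>2) \<partial>B) * (\<integral>\<^sup>+\<theta>. G (\<phi> (t, \<theta>)) \<partial>B) \<partial>T)
         \<le> ennreal C * (\<integral>\<^sup>+s. G s \<partial>S)"
  shows "bounded_op (L2space S) (L2space T) (\<lambda>g t. LINT \<theta>|B. k (t, \<theta>) * g (\<phi> (t, \<theta>)))"
proof (rule bounded_op_L2spaceI[OF _ _ assms(4)])
  note * = integral_operator_AE[OF assms]
  fix f g assume fg: "f \<in> L2 S" "g \<in> L2 S"
  show "AE t in T. (LINT \<theta>|B. k (t, \<theta>) * (f (\<phi> (t, \<theta>)) + g (\<phi> (t, \<theta>)))) =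
      (LINT \<theta>|B. k (t, \<theta>) * f (\<phi> (t, \<theta>))) + (LINT \<theta>|B. k (t, \<theta>) * g (\<phi> (t, \<theta>)))"
    using *(2)[OF fg(1)] *(2)[OF fg(2)]
    by eventually_elim (simp add: distrib_left)
next
  fix c and g assume "g \<in> L2 S"
  show "AE t in T. (LINT \<theta>|B. k (t, \<theta>) * (c * g (\<phi> (t, \<theta>)))) = c * (LINT \<theta>|B. k (t, \<theta>) * g (\<phi> (t, \<theta>)))"
    by (simp add: mult.left_commute[of _ c])
qed (use integral_operator_AE[OF assms] in auto)

lemma bounded_op_pointwise_matrix:
  assumes "\<phi> \<in> measurable T S" "\<And>i j. i < m \<Longrightarrow> j < n \<Longrightarrow> k i j \<in> borel_measurable T"
    and C: "\<And>i j. i < m \<Longrightarrow> j < n \<Longrightarrow> \<exists>C\<ge>0. \<forall>G\<in>borel_measurable S.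
       (\<integral>\<^sup>+t. ennreal ((k i j t)\<^sup>2) * G (\<phi> t) \<partial>T) \<le> ennreal C * (\<integral>\<^sup>+s. G s \<partial>S)"
    and F: "\<And>u t i. t \<in> space T \<Longrightarrow> i < m \<Longrightarrow> F u t i = (\<Sum>j<n. k i j t * u (\<phi> t) j)"
  shows "bounded_op (L2vec n S) (L2vec m T) F"
proof (rule bounded_op_matrix)
  show "bounded_op (L2space S) (L2space T) (\<lambda>g t. k i j t * g (\<phi> t))" if "i < m" "j < n" for i j
    using C[OF that] bounded_op_pointwise[OF assms(1) assms(2)[OF that]] by blast
  fix u i assume u: "u \<in> carr (L2vec n S)" and i: "i < m"
  note [measurable] = assms(1)
  have [measurable]: "j < n \<Longrightarrow> (\<lambda>s. u s j) \<in> borel_measurable S" for j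
    using u by (simp add: carr_L2vec L2_def)
  have [measurable]: "j < n \<Longrightarrow> k i j \<in> borel_measurable T" for j
    using assms(2) i by simp
  have "(\<lambda>t. \<Sum>j<n. k i j t * u (\<phi> t) j) \<in> borel_measurable T"
    by (intro borel_measurable_sum borel_measurable_times) (auto intro: measurable_compose[OF assms(1)])
  then show "(\<lambda>t. F u t i) \<in> borel_measurable T"
    by (subst measurable_cong[OF F[OF _ i]])
  show "AE t in T. F u t i = (\<Sum>j<n. k i j t * u (\<phi> t) j)"
    by (intro AE_I2 F i)
qed

lemma bounded_op_integral_matrix:
  assumes "sigma_finite_measure B"
    and "\<phi> \<in> measurable (T \<Otimes>\<^sub>M B) S"
    and k: "\<And>i j. i < m \<Longrightarrow> j < n \<Longrightarrow> k i j \<in> borel_measurable (T \<Otimes>\<^sub>M B)"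
    and C: "\<And>i j. i < m \<Longrightarrow> j < n \<Longrightarrow> \<exists>C\<ge>0. \<forall>G\<in>borel_measurable S.
       (\<integral>\<^sup>+t. (\<integral>\<^sup>+\<theta>. ennreal ((k i j (t, \<theta>))\<^sup>2) \<partial>B) * (\<integral>\<^sup>+\<theta>. G (\<phi> (t, \<theta>)) \<partial>B) \<partial>T)
         \<le> ennreal C * (\<integral>\<^sup>+s. G s \<partial>S)"
    and F: "\<And>u t i. t \<in> space T \<Longrightarrow> i < m \<Longrightarrow>
       F u t i = (LINT \<theta>|B. (\<Sum>j<n. k i j (t, \<theta>) * u (\<phi> (t, \<theta>)) j))"
  shows "bounded_op (L2vec n S) (L2vec m T) F"
proof (rule bounded_op_matrix)
  interpret B: sigma_finite_measure B by fact
  show "bounded_op (L2space S) (L2space T) (\<lambda>g t. LINT \<theta>|B. k i j (t, \<theta>) * g (\<phi> (t, \<theta>)))"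
    if "i < m" "j < n" for i j
    using C[OF that] bounded_op_integral_operator[OF assms(1,2) k[OF that]] by blast
  fix u i assume u: "u \<in> carr (L2vec n S)" and i: "i < m"
  have uj: "j < n \<Longrightarrow> (\<lambda>s. u s j) \<in> L2 S" for j
    using u by (simp add: carr_L2vec)
  have "(\<lambda>p. k i j p * u (\<phi> p) j) \<in> borel_measurable (T \<Otimes>\<^sub>M B)" if "j < n" for j
    using k[OF i that] measurable_compose[OF assms(2) L2_measurable[OF uj[OF that]]]
    by (rule borel_measurable_times)
  then have [measurable]: "(\<lambda>p. \<Sum>j<n. k i j p * u (\<phi> p) j) \<in> borel_measurable (T \<Otimes>\<^sub>M B)"
    by (intro borel_measurable_sum) auto
  have "(\<lambda>(t, \<theta>). \<Sum>j<n. k i j (t, \<theta>) * u (\<phi> (t, \<theta>)) j) \<in> borel_measurable (T \<Otimes>\<^sub>M B)"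
    by (simp add: case_prod_beta')
  then have "(\<lambda>t. LINT \<theta>|B. (\<Sum>j<n. k i j (t, \<theta>) * u (\<phi> (t, \<theta>)) j)) \<in> borel_measurable T"
    by (rule B.borel_measurable_lebesgue_integral)
  then show "(\<lambda>t. F u t i) \<in> borel_measurable T"
    by (subst measurable_cong[OF F[OF _ i]])
  have "AE t in T. \<forall>j\<in>{..<n}. integrable B (\<lambda>\<theta>. k i j (t, \<theta>) * u (\<phi> (t, \<theta>)) j)"
    using C[OF i] integral_operator_AE(2)[OF assms(1,2) k[OF i] _ _ uj]
    by (intro AE_finite_allI) (auto, blast)
  then show "AE t in T. F u t i = (\<Sum>j<n. LINT \<theta>|B. k i j (t, \<theta>) * u (\<phi> (t, \<theta>)) j)"
    using AE_space
    by eventually_elim (auto simp: F[OF _ i] intro!: Bochner_Integration.integral_sum)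
qed

section \<open>Spaces built from components\<close>

text \<open>
  A product of two spaces, seen through coordinate maps \<open>f\<close> and \<open>g\<close> instead of pairs: the nested tuples
  of functions that make up a state are products of this kind of spaces of vector valued functions,
  but only after a rearrangement of their arguments.
\<close>
definition sqjoin :: "('p \<Rightarrow> 'a) \<Rightarrow> 'a sqspace \<Rightarrow> ('p \<Rightarrow> 'b) \<Rightarrow> 'b sqspace \<Rightarrow> 'p sqspace" where
  "sqjoin f X g Y = ({p. f p \<in> carr X \<and> g p \<in> carr Y}, \<lambda>p. sqnorm X (f p) + sqnorm Y (g p))"

context
  fixes f :: "'p::real_vector \<Rightarrow> 'a::real_vector" and g :: "'p \<Rightarrow> 'b::real_vector"
  assumes f: "linear f" and g: "linear g"
begin

lemma sqspace_sqjoin: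
  assumes "sqspace X" "sqspace Y"
  shows "sqspace (sqjoin f X g Y)"
  unfolding sqspace_def sqjoin_def carr_sqnorm_Pair
proof (intro conjI ballI allI)
  fix p q assume *: "p \<in> {p. f p \<in> carr X \<and> g p \<in> carr Y}" "q \<in> {p. f p \<in> carr X \<and> g p \<in> carr Y}"
  then show "sqnorm X (f (p + q)) + sqnorm Y (g (p + q))
      \<le> 2 * (sqnorm X (f p) + sqnorm Y (g p)) + 2 * (sqnorm X (f q) + sqnorm Y (g q))"
    using sqspace_sqnorm(3)[OF assms(1), of "f p" "f q"] sqspace_sqnorm(3)[OF assms(2), of "g p" "g q"]
    by (simp add: linear_add[OF f] linear_add[OF g])
qed (use assms in \<open>auto simp: subspace_def linear_0 linear_add linear_scale f g sqspace_closed
    sqspace_sqnorm algebra_simps\<close>)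

lemma eqv_sqjoin_iff:
  assumes "sqspace X" "sqspace Y"
  shows "eqv (sqjoin f X g Y) p q \<longleftrightarrow> eqv X (f p) (f q) \<and> eqv Y (g p) (g q)"
  using sqspace_sqnorm(1)[OF assms(1) sqspace_closed(3)[OF assms(1)], of "f p" "f q"]
    sqspace_sqnorm(1)[OF assms(2) sqspace_closed(3)[OF assms(2)], of "g p" "g q"]
  by (auto simp: eqv_def sqjoin_def linear_diff f g)

lemma bounded_op_sqjoin_projections:
  assumes "sqspace X" "sqspace Y"
  shows "bounded_op (sqjoin f X g Y) X f" "bounded_op (sqjoin f X g Y) Y g"
  unfolding bounded_op_def
  using assms
  by (auto simp: sqjoin_def linear_add linear_scale f g sqspace_closed sqspace_sqnorm
      intro!: exI[of _ 1] eqv_refl)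

lemma bounded_op_sqjoinI:
  assumes "sqspace W" "sqspace X" "sqspace Y" "bounded_op W X (\<lambda>w. f (F w))" "bounded_op W Y (\<lambda>w. g (F w))"
  shows "bounded_op W (sqjoin f X g Y) F"
proof -
  obtain C where C: "0 \<le> C" "\<And>w. w \<in> carr W \<Longrightarrow> sqnorm X (f (F w)) \<le> C * sqnorm W w"
    using bounded_op_bound[OF assms(4)] by blast
  obtain D where D: "0 \<le> D" "\<And>w. w \<in> carr W \<Longrightarrow> sqnorm Y (g (F w)) \<le> D * sqnorm W w"
    using bounded_op_bound[OF assms(5)] by blast
  have "sqnorm (sqjoin f X g Y) (F w) \<le> (C + D) * sqnorm W w" if "w \<in> carr W" for w
    using C(2)[OF that] D(2)[OF that] by (simp add: sqjoin_def algebra_simps)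
  moreover have "0 \<le> C + D" using C D by simp
  ultimately show ?thesis
    using assms(4,5) unfolding bounded_op_def
    by (auto simp: eqv_sqjoin_iff assms(2,3) linear_add linear_scale f g) (auto simp: sqjoin_def)
qed

end

section \<open>Integrals over intervals and products\<close>

lemma measurable_leb_borel [measurable]: "(\<lambda>x. x) \<in> borel_measurable (leb a b)"
  by (intro measurable_restrict_space1) auto

lemma LINT_leb: "(LINT x:{a..b}|lborel. f x) = (LINT x|leb a b. f x)" for f :: "real \<Rightarrow> real"
  by (simp add: set_lebesgue_integral_def integral_restrict_space)

text \<open>
  An integral with a variable limit becomes an integral over a fixed interval with a cut-off
  kernel, valid for limits inside the interval.
\<close>
lemma LINT_leb_lower:
  fixes f :: "real \<Rightarrow> real"
  assumes "x \<in> {a..b}"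
  shows "(LINT \<theta>:{a..x}|lborel. f \<theta>) = (LINT \<theta>|leb a b. (if \<theta> \<le> x then f \<theta> else 0))"
  unfolding LINT_leb[symmetric] set_lebesgue_integral_def
  using assms by (intro Bochner_Integration.integral_cong) (auto simp: indicator_def)

lemma LINT_leb_upper:
  fixes f :: "real \<Rightarrow> real"
  assumes "x \<in> {a..b}"
  shows "(LINT \<theta>:{x..b}|lborel. f \<theta>) = (LINT \<theta>|leb a b. (if x \<le> \<theta> then f \<theta> else 0))"
  unfolding LINT_leb[symmetric] set_lebesgue_integral_def
  using assms by (intro Bochner_Integration.integral_cong) (auto simp: indicator_def)

lemma space_leb: "space (leb a b) = {a..b}"
  by (simp add: space_restrict_space)

lemma emeasure_leb: "emeasure (leb a b) {a..b} = emeasure lborel {a..b}"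
  by (simp add: emeasure_restrict_space)

lemma finite_measure_leb: "finite_measure (leb a b)"
  by (rule finite_measureI) (simp add: space_leb emeasure_leb emeasure_lborel_Icc_eq)

lemma unit_interval_measure [simp]:
  "emeasure (leb 0 1) {0..1} = 1" "measure (leb 0 1) {0..1} = 1"
  by (simp_all add: emeasure_leb measure_def)

lemma sigma_finite_if_finite: "finite_measure M \<Longrightarrow> sigma_finite_measure M"
  by (simp add: finite_measure_def)

lemma nn_integral_product:
  assumes "sigma_finite_measure N"
    and [measurable]: "f \<in> borel_measurable M" "g \<in> borel_measurable N"
  shows "(\<integral>\<^sup>+z. f (fst z) * g (snd z) \<partial>(M \<Otimes>\<^sub>M N)) = (\<integral>\<^sup>+x. f x \<partial>M) * (\<integral>\<^sup>+y. g y \<partial>N)"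
proof -
  interpret N: sigma_finite_measure N by fact
  have "(\<integral>\<^sup>+z. f (fst z) * g (snd z) \<partial>(M \<Otimes>\<^sub>M N)) = (\<integral>\<^sup>+x. \<integral>\<^sup>+y. f x * g y \<partial>N \<partial>M)"
    by (subst N.nn_integral_fst[symmetric]) auto
  then show ?thesis
    by (simp add: nn_integral_cmult nn_integral_multc)
qed

lemma nn_integral_iterated_swap:
  assumes "sigma_finite_measure M" "sigma_finite_measure N"
    and [measurable]: "G \<in> borel_measurable (M \<Otimes>\<^sub>M N)"
  shows "(\<integral>\<^sup>+y. \<integral>\<^sup>+x. G (x, y) \<partial>M \<partial>N) = (\<integral>\<^sup>+z. G z \<partial>(M \<Otimes>\<^sub>M N))"
proof -
  interpret pair_sigma_finite M N
    using assms by (simp add: pair_sigma_finite_def)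
  show ?thesis by (rule nn_integral_snd) measurable
qed

lemma nn_integral_le_measure:
  assumes "finite_measure M" "\<And>x. x \<in> space M \<Longrightarrow> \<bar>k x\<bar> \<le> 1"
  shows "(\<integral>\<^sup>+x. ennreal ((k x)\<^sup>2) \<partial>M) \<le> ennreal (measure M (space M))"
proof -
  interpret finite_measure M by fact
  have "ennreal ((k x)\<^sup>2) \<le> 1" if "x \<in> space M" for x
    using assms(2)[OF that] by (simp add: abs_square_le_1)
  then have "(\<integral>\<^sup>+x. ennreal ((k x)\<^sup>2) \<partial>M) \<le> (\<integral>\<^sup>+x. 1 \<partial>M)"
    by (intro nn_integral_mono)
  then show ?thesis by (simp add: emeasure_eq_measure)
qed

text \<open>
  On a finite measure space a kernel of modulus at most 1 has \<open>\<integral>k\<^sup>2 \<le> measure B (space B)\<close>, so that only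
  the second factor of the transfer inequality is left to be estimated.
\<close>
lemma transfer_bounded_kernel:
  assumes B: "finite_measure B"
    and k: "\<And>t \<theta>. \<bar>k (t, \<theta>)\<bar> \<le> 1"
    and c: "\<And>G. G \<in> borel_measurable S \<Longrightarrow> (\<lambda>t. \<integral>\<^sup>+\<theta>. G (\<phi> (t, \<theta>)) \<partial>B) \<in> borel_measurable T \<and>
       (\<integral>\<^sup>+t. \<integral>\<^sup>+\<theta>. G (\<phi> (t, \<theta>)) \<partial>B \<partial>T) \<le> ennreal c * (\<integral>\<^sup>+s. G s \<partial>S)" and "0 \<le> c"
  shows "\<exists>C\<ge>0. \<forall>G\<in>borel_measurable S.
       (\<integral>\<^sup>+t. (\<integral>\<^sup>+\<theta>. ennreal ((k (t, \<theta>))\<^sup>2) \<partial>B) * (\<integral>\<^sup>+\<theta>. G (\<phi> (t, \<theta>)) \<partial>B) \<partial>T)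
         \<le> ennreal C * (\<integral>\<^sup>+s. G s \<partial>S)"
proof (intro exI[of _ "measure B (space B) * c"] conjI ballI)
  fix G :: "_ \<Rightarrow> ennreal" assume G: "G \<in> borel_measurable S"
  have "(\<integral>\<^sup>+t. (\<integral>\<^sup>+\<theta>. ennreal ((k (t, \<theta>))\<^sup>2) \<partial>B) * (\<integral>\<^sup>+\<theta>. G (\<phi> (t, \<theta>)) \<partial>B) \<partial>T)
     \<le> (\<integral>\<^sup>+t. ennreal (measure B (space B)) * (\<integral>\<^sup>+\<theta>. G (\<phi> (t, \<theta>)) \<partial>B) \<partial>T)"
    using k by (intro nn_integral_mono mult_right_mono nn_integral_le_measure B) auto
  also have "\<dots> = ennreal (measure B (space B)) * (\<integral>\<^sup>+t. (\<integral>\<^sup>+\<theta>. G (\<phi> (t, \<theta>)) \<partial>B) \<partial>T)"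
    using c[OF G] by (intro nn_integral_cmult) auto
  also have "\<dots> \<le> ennreal (measure B (space B)) * (ennreal c * (\<integral>\<^sup>+s. G s \<partial>S))"
    using c[OF G] by (intro mult_left_mono) auto
  finally show "(\<integral>\<^sup>+t. (\<integral>\<^sup>+\<theta>. ennreal ((k (t, \<theta>))\<^sup>2) \<partial>B) * (\<integral>\<^sup>+\<theta>. G (\<phi> (t, \<theta>)) \<partial>B) \<partial>T)
     \<le> ennreal (measure B (space B) * c) * (\<integral>\<^sup>+s. G s \<partial>S)"
    using \<open>0 \<le> c\<close> by (simp add: ennreal_mult mult.assoc)
qed (use \<open>0 \<le> c\<close> in auto)

text \<open>
  The case in which components are not mixed; every integration in \<open>y\<close> in a PI operator is of this kind,
  with \<open>k\<close> either 1 or the cut-off at a variable limit.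
\<close>
lemma bounded_op_scalar_integral:
  assumes B: "finite_measure B"
    and [measurable]: "\<phi> \<in> measurable (T \<Otimes>\<^sub>M B) S" "k \<in> borel_measurable (T \<Otimes>\<^sub>M B)"
    and k: "\<And>t \<theta>. \<bar>k (t, \<theta>)\<bar> \<le> 1"
    and c: "\<And>G. G \<in> borel_measurable S \<Longrightarrow>
       (\<integral>\<^sup>+t. \<integral>\<^sup>+\<theta>. G (\<phi> (t, \<theta>)) \<partial>B \<partial>T) \<le> ennreal c * (\<integral>\<^sup>+s. G s \<partial>S)" and "0 \<le> c"
    and F: "\<And>u t i. t \<in> space T \<Longrightarrow> i < n \<Longrightarrow>
       F u t i = (LINT \<theta>|B. k (t, \<theta>) * u (\<phi> (t, \<theta>)) i)"
  shows "bounded_op (L2vec n S) (L2vec n T) F"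
proof (rule bounded_op_integral_matrix[where k = "\<lambda>i j z. if i = j then k z else 0"])
  interpret finite_measure B by fact
  show "sigma_finite_measure B" ..
  show "\<phi> \<in> measurable (T \<Otimes>\<^sub>M B) S" by fact
  show "(\<lambda>z. if i = j then k z else 0) \<in> borel_measurable (T \<Otimes>\<^sub>M B)" for i j :: nat
    by measurable
  show "F u t i = (LINT \<theta>|B. (\<Sum>j<n. (if i = j then k (t, \<theta>) else 0) * u (\<phi> (t, \<theta>)) j))"
    if "t \<in> space T" "i < n" for u t i
    using that by (simp add: F if_distrib[of "\<lambda>x. x * _"] cong: if_cong)
  show "\<exists>C\<ge>0. \<forall>G\<in>borel_measurable S.
       (\<integral>\<^sup>+t. (\<integral>\<^sup>+\<theta>. ennreal ((if i = j then k (t, \<theta>) else 0)\<^sup>2) \<partial>B) * (\<integral>\<^sup>+\<theta>. G (\<phi> (t, \<theta>)) \<partial>B) \<partial>T)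
         \<le> ennreal C * (\<integral>\<^sup>+s. G s \<partial>S)" for i j :: nat
  proof (rule transfer_bounded_kernel[OF B _ _ \<open>0 \<le> c\<close>])
    fix G :: "_ \<Rightarrow> ennreal" assume G[measurable]: "G \<in> borel_measurable S"
    show "(\<lambda>t. \<integral>\<^sup>+\<theta>. G (\<phi> (t, \<theta>)) \<partial>B) \<in> borel_measurable T \<and>
       (\<integral>\<^sup>+t. \<integral>\<^sup>+\<theta>. G (\<phi> (t, \<theta>)) \<partial>B \<partial>T) \<le> ennreal c * (\<integral>\<^sup>+s. G s \<partial>S)"
      by (intro conjI c G) measurable
  qed (use k in auto)
qed

section \<open>Constant extension and integration in the second variable\<close>

text \<open>
  Families of elements of $\mathbb{R}^{n_0} \times L_2^{n_1}$ indexed by \<open>y\<close>, which is the form in which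
  the definition of a PI operator presents $L_2^{n_0}[\Omega_2] \times L_2^{n_1}[\Omega_1\times\Omega_2]$.
\<close>
definition rl_field_space :: "real measure \<Rightarrow> real measure \<Rightarrow> nat \<Rightarrow> nat \<Rightarrow> (real \<Rightarrow> rl) sqspace" where
  "rl_field_space A N n0 n1 = sqjoin (\<lambda>p y. fst (p y)) (L2vec n0 N) (\<lambda>p (x, y). snd (p y) x) (L2vec n1 (A \<Otimes>\<^sub>M N))"

text \<open>
  Vectors in $\mathbb{R}^{n_0}$ are treated as constant functions on the unit interval: as it has
  measure 1, the norm is the Euclidean one, and the lemmas on vectors of functions apply to them.
\<close>
definition rl_space :: "real measure \<Rightarrow> nat \<Rightarrow> nat \<Rightarrow> rl sqspace" where
  "rl_space A n0 n1 = sqjoin (\<lambda>u t. fst u) (L2vec n0 (leb 0 1)) snd (L2vec n1 A)"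

lemma linear_rl_field_components: "linear (\<lambda>(p::real \<Rightarrow> rl) y. fst (p y))" "linear (\<lambda>(p::real \<Rightarrow> rl) (x, y). snd (p y) x)"
  by (auto intro!: linearI simp: plus_fun_def scaleR_fun_def)

lemma linear_rl_components: "linear (\<lambda>(u::rl) (t::real). fst u)" "linear (snd :: rl \<Rightarrow> _)"
  by (auto intro!: linearI simp: plus_fun_def scaleR_fun_def)

lemma sqspace_rl_field: "sqspace (rl_field_space A N n0 n1)"
  unfolding rl_field_space_def by (intro sqspace_sqjoin linear_rl_field_components sqspace_L2vec)

lemma sqspace_rl: "sqspace (rl_space A n0 n1)"
  unfolding rl_space_def by (intro sqspace_sqjoin linear_rl_components sqspace_L2vec)

lemma bounded_op_rl_field_components:
  "bounded_op (rl_field_space A N n0 n1) (L2vec n0 N) (\<lambda>p y. fst (p y))"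
  "bounded_op (rl_field_space A N n0 n1) (L2vec n1 (A \<Otimes>\<^sub>M N)) (\<lambda>p (x, y). snd (p y) x)"
  unfolding rl_field_space_def by (rule bounded_op_sqjoin_projections[OF linear_rl_field_components sqspace_L2vec sqspace_L2vec])+

lemma bounded_op_rl_components:
  "bounded_op (rl_space A n0 n1) (L2vec n0 (leb 0 1)) (\<lambda>u t. fst u)"
  "bounded_op (rl_space A n0 n1) (L2vec n1 A) snd"
  unfolding rl_space_def by (rule bounded_op_sqjoin_projections[OF linear_rl_components sqspace_L2vec sqspace_L2vec])+

lemma bounded_op_rl_field_from_component:
  assumes "sqspace Y"
  shows "bounded_op (L2vec n0 N) Y F \<Longrightarrow> bounded_op (rl_field_space A N n0 n1) Y (\<lambda>p. F (\<lambda>y. fst (p y)))"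
    and "bounded_op (L2vec n1 (A \<Otimes>\<^sub>M N)) Y G \<Longrightarrow> bounded_op (rl_field_space A N n0 n1) Y (\<lambda>p. G (\<lambda>(x, y). snd (p y) x))"
  by (rule bounded_op_comp[OF sqspace_rl_field sqspace_L2vec assms bounded_op_rl_field_components(1)], assumption)
    (rule bounded_op_comp[OF sqspace_rl_field sqspace_L2vec assms bounded_op_rl_field_components(2)], assumption)

lemma bounded_op_rl_from_component:
  assumes "sqspace Y"
  shows "bounded_op (L2vec n0 (leb 0 1)) Y F \<Longrightarrow> bounded_op (rl_space A n0 n1) Y (\<lambda>u. F (\<lambda>t. fst u))"
    and "bounded_op (L2vec n1 A) Y G \<Longrightarrow> bounded_op (rl_space A n0 n1) Y (\<lambda>u. G (snd u))"
  by (rule bounded_op_comp[OF sqspace_rl sqspace_L2vec assms bounded_op_rl_components(1)], assumption)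
    (rule bounded_op_comp[OF sqspace_rl sqspace_L2vec assms bounded_op_rl_components(2)], assumption)

lemma bounded_op_rl_fieldI:
  assumes "sqspace W" "bounded_op W (L2vec n0 N) (\<lambda>w y. fst (F w y))"
    "bounded_op W (L2vec n1 (A \<Otimes>\<^sub>M N)) (\<lambda>w (x, y). snd (F w y) x)"
  shows "bounded_op W (rl_field_space A N n0 n1) F"
  unfolding rl_field_space_def
  by (rule bounded_op_sqjoinI[OF linear_rl_field_components assms(1) sqspace_L2vec sqspace_L2vec]) (rule assms)+

lemma bounded_op_rlI:
  assumes "sqspace W" "bounded_op W (L2vec n0 (leb 0 1)) (\<lambda>w t. fst (F w))" "bounded_op W (L2vec n1 A) (\<lambda>w. snd (F w))"
  shows "bounded_op W (rl_space A n0 n1) F"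
  unfolding rl_space_def
  by (rule bounded_op_sqjoinI[OF linear_rl_components assms(1) sqspace_L2vec sqspace_L2vec]) (rule assms)+

text \<open>
  Together with \<open>bounded_op_rl_integral\<close> this moves between elements and families of elements.  On
  vectors, the constant function is obtained by integrating over the unit interval.
\<close>
lemma bounded_op_const:
  assumes N: "finite_measure N"
  shows "bounded_op (rl_space A n0 n1) (rl_field_space A N n0 n1) (\<lambda>u y. u)"
proof (rule bounded_op_rl_fieldI[OF sqspace_rl])
  interpret N: finite_measure N by fact
  have *: "bounded_op (L2vec n0 (leb 0 1)) (L2vec n0 N) (\<lambda>u y i. LINT t|leb 0 1. u t i)"
    by (rule bounded_op_scalar_integral[where \<phi> = snd and k = "\<lambda>_. 1" and c = "measure N (space N)", OF finite_measure_leb])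
      (auto simp: N.emeasure_eq_measure mult.commute)
  show "bounded_op (rl_space A n0 n1) (L2vec n0 N) (\<lambda>w y. fst w)"
    using bounded_op_rl_from_component(1)[OF sqspace_L2vec *] by (simp add: space_leb)
  have "bounded_op (L2vec n1 A) (L2vec n1 (A \<Otimes>\<^sub>M N)) (\<lambda>u (x, y). u x)"
  proof (rule bounded_op_pointwise_matrix[where \<phi> = fst and k = "\<lambda>i j _. if i = j then 1 else 0"])
    show "\<exists>C\<ge>0. \<forall>G\<in>borel_measurable A. (\<integral>\<^sup>+t. ennreal ((if i = j then 1 else 0)\<^sup>2) * G (fst t) \<partial>(A \<Otimes>\<^sub>M N))
        \<le> ennreal C * integral\<^sup>N A G" for i j :: nat
    proof (intro exI[of _ "measure N (space N)"] conjI ballI)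
      fix G :: "_ \<Rightarrow> ennreal" assume [measurable]: "G \<in> borel_measurable A"
      have "(\<integral>\<^sup>+t. ennreal ((if i = j then 1 else 0)\<^sup>2) * G (fst t) \<partial>(A \<Otimes>\<^sub>M N)) \<le> (\<integral>\<^sup>+t. G (fst t) \<partial>(A \<Otimes>\<^sub>M N))"
        by (intro nn_integral_mono) auto
      also have "\<dots> = (\<integral>\<^sup>+x. \<integral>\<^sup>+y. G x \<partial>N \<partial>A)"
        by (subst N.nn_integral_fst[symmetric]) auto
      finally show "(\<integral>\<^sup>+t. ennreal ((if i = j then 1 else 0)\<^sup>2) * G (fst t) \<partial>(A \<Otimes>\<^sub>M N))
        \<le> ennreal (measure N (space N)) * integral\<^sup>N A G"
        by (simp add: N.emeasure_eq_measure nn_integral_multc mult.commute)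
    qed simp
  qed (auto simp: if_distrib[of "\<lambda>x. x * _"] cong: if_cong)
  from bounded_op_rl_from_component(2)[OF sqspace_L2vec this]
  show "bounded_op (rl_space A n0 n1) (L2vec n1 (A \<Otimes>\<^sub>M N)) (\<lambda>w (x, y). snd w x)" .
qed

lemma bounded_op_rl_integral:
  "bounded_op (rl_field_space A (leb c d) n0 n1) (rl_space A n0 n1) (rl_integral {c..d})"
proof (rule bounded_op_rlI[OF sqspace_rl_field])
  interpret C: finite_measure "leb c d" by (rule finite_measure_leb)
  have *: "bounded_op (L2vec n0 (leb c d)) (L2vec n0 (leb 0 1)) (\<lambda>u t i. LINT y|leb c d. u y i)"
    by (rule bounded_op_scalar_integral[where \<phi> = snd and k = "\<lambda>_. 1" and c = 1, OF finite_measure_leb])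
      (auto simp: space_leb)
  show "bounded_op (rl_field_space A (leb c d) n0 n1) (L2vec n0 (leb 0 1)) (\<lambda>w t. fst (rl_integral {c..d} w))"
    using bounded_op_rl_field_from_component(1)[OF sqspace_L2vec *] by (simp add: rl_integral_def LINT_leb)
  have "bounded_op (L2vec n1 (A \<Otimes>\<^sub>M leb c d)) (L2vec n1 A) (\<lambda>u x i. LINT y|leb c d. u (x, y) i)"
  proof (rule bounded_op_scalar_integral[where \<phi> = "\<lambda>z. z" and k = "\<lambda>_. 1" and c = 1, OF finite_measure_leb])
    fix G :: "_ \<Rightarrow> ennreal" assume [measurable]: "G \<in> borel_measurable (A \<Otimes>\<^sub>M leb c d)"
    show "(\<integral>\<^sup>+t. \<integral>\<^sup>+\<theta>. G (t, \<theta>) \<partial>leb c d \<partial>A) \<le> ennreal 1 * integral\<^sup>N (A \<Otimes>\<^sub>M leb c d) G"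
      by (simp add: C.nn_integral_fst)
  qed auto
  from bounded_op_rl_field_from_component(2)[OF sqspace_L2vec this]
  show "bounded_op (rl_field_space A (leb c d) n0 n1) (L2vec n1 A) (\<lambda>w. snd (rl_integral {c..d} w))"
    by (simp add: rl_integral_def LINT_leb)
qed

text \<open>
  Integration over a \<open>y\<close>-dependent subinterval, for both choices of the variable limit at once.
\<close>
lemma bounded_op_weighted_rl_integral:
  fixes h :: "real \<times> real \<Rightarrow> real"
  assumes h[measurable]: "h \<in> borel_measurable (leb c d \<Otimes>\<^sub>M leb c d)" and h1: "\<And>z. \<bar>h z\<bar> \<le> 1"
    and I: "\<And>(f :: real \<Rightarrow> real) y. y \<in> {c..d} \<Longrightarrow> (LINT \<nu>:I y|lborel. f \<nu>) = (LINT \<nu>|leb c d. h (y, \<nu>) * f \<nu>)"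
  shows "bounded_op (rl_field_space A (leb c d) n0 n1) (rl_field_space A (leb c d) n0 n1) (\<lambda>p y. rl_integral (I y) p)"
proof (rule bounded_op_rl_fieldI[OF sqspace_rl_field])
  interpret C: finite_measure "leb c d" by (rule finite_measure_leb)
  have *: "bounded_op (L2vec n0 (leb c d)) (L2vec n0 (leb c d)) (\<lambda>u y i. LINT \<nu>:I y|lborel. u \<nu> i)"
  proof (rule bounded_op_scalar_integral[where \<phi> = snd and k = h and c = "measure (leb c d) (space (leb c d))", OF C.finite_measure_axioms])
    show "(LINT \<nu>:I y|lborel. u \<nu> i) = (LINT \<theta>|leb c d. h (y, \<theta>) * u (snd (y, \<theta>)) i)"
      if "y \<in> space (leb c d)" for u y and i :: nat
      using I[of y] that by (simp add: space_leb)
  qed (use h1 in \<open>auto simp: C.emeasure_eq_measure mult.commute\<close>)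
  show "bounded_op (rl_field_space A (leb c d) n0 n1) (L2vec n0 (leb c d)) (\<lambda>w y. fst (rl_integral (I y) w))"
    using bounded_op_rl_field_from_component(1)[OF sqspace_L2vec *] by (simp add: rl_integral_def)
  have "bounded_op (L2vec n1 (A \<Otimes>\<^sub>M leb c d)) (L2vec n1 (A \<Otimes>\<^sub>M leb c d))
      (\<lambda>u (x, y) i. LINT \<nu>:I y|lborel. u (x, \<nu>) i)"
  proof (rule bounded_op_scalar_integral[where \<phi> = "\<lambda>z. (fst (fst z), snd z)"
        and k = "\<lambda>z. h (snd (fst z), snd z)" and c = "measure (leb c d) (space (leb c d))", OF C.finite_measure_axioms])
    fix G :: "_ \<Rightarrow> ennreal" assume [measurable]: "G \<in> borel_measurable (A \<Otimes>\<^sub>M leb c d)"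
    have "(\<integral>\<^sup>+t. \<integral>\<^sup>+\<theta>. G (fst t, \<theta>) \<partial>leb c d \<partial>(A \<Otimes>\<^sub>M leb c d))
        = (\<integral>\<^sup>+x. \<integral>\<^sup>+y. \<integral>\<^sup>+\<theta>. G (x, \<theta>) \<partial>leb c d \<partial>leb c d \<partial>A)"
      by (subst C.nn_integral_fst[symmetric]) auto
    also have "\<dots> = emeasure (leb c d) (space (leb c d)) * (\<integral>\<^sup>+x. \<integral>\<^sup>+\<theta>. G (x, \<theta>) \<partial>leb c d \<partial>A)"
      by (simp add: nn_integral_cmult mult.commute)
    also have "\<dots> = ennreal (measure (leb c d) (space (leb c d))) * integral\<^sup>N (A \<Otimes>\<^sub>M leb c d) G"
      by (simp add: C.nn_integral_fst C.emeasure_eq_measure)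
    finally show "(\<integral>\<^sup>+t. \<integral>\<^sup>+\<theta>. G (fst (fst (t, \<theta>)), snd (t, \<theta>)) \<partial>leb c d \<partial>(A \<Otimes>\<^sub>M leb c d))
       \<le> ennreal (measure (leb c d) (space (leb c d))) * integral\<^sup>N (A \<Otimes>\<^sub>M leb c d) G"
      by simp
  next
    show "(\<lambda>(x, y) i. LINT \<nu>:I y|lborel. u (x, \<nu>) i) t i =
       (LINT \<theta>|leb c d. h (snd (fst (t, \<theta>)), snd (t, \<theta>)) * u (fst (fst (t, \<theta>)), snd (t, \<theta>)) i)"
      if "t \<in> space (A \<Otimes>\<^sub>M leb c d)" for u t and i :: nat
      using I[of "snd t"] that by (auto simp: space_leb space_pair_measure)
  qed (use h1 in auto)
  from bounded_op_rl_field_from_component(2)[OF sqspace_L2vec this]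
  show "bounded_op (rl_field_space A (leb c d) n0 n1) (L2vec n1 (A \<Otimes>\<^sub>M leb c d)) (\<lambda>w (x, y). snd (rl_integral (I y) w) x)"
    by (simp add: rl_integral_def case_prod_beta')
qed

lemma bounded_op_partial_rl_integral:
  "bounded_op (rl_field_space A (leb c d) n0 n1) (rl_field_space A (leb c d) n0 n1) (\<lambda>p y. rl_integral {c..y} p)"
  "bounded_op (rl_field_space A (leb c d) n0 n1) (rl_field_space A (leb c d) n0 n1) (\<lambda>p y. rl_integral {y..d} p)"
proof -
  show "bounded_op (rl_field_space A (leb c d) n0 n1) (rl_field_space A (leb c d) n0 n1) (\<lambda>p y. rl_integral {c..y} p)"
    by (rule bounded_op_weighted_rl_integral[where h = "\<lambda>(y, \<nu>). if \<nu> \<le> y then 1 else 0"])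
      (auto simp: LINT_leb_lower intro!: Bochner_Integration.integral_cong)
  show "bounded_op (rl_field_space A (leb c d) n0 n1) (rl_field_space A (leb c d) n0 n1) (\<lambda>p y. rl_integral {y..d} p)"
    by (rule bounded_op_weighted_rl_integral[where h = "\<lambda>(y, \<nu>). if y \<le> \<nu> then 1 else 0"])
      (auto simp: LINT_leb_upper intro!: Bochner_Integration.integral_cong)
qed

section \<open>4-PI operators\<close>

lemma bounded_op_const_matrix:
  fixes M :: mat
  shows "bounded_op (L2vec n N) (L2vec m N) (\<lambda>u y. mat_vec n M (u y))"
proof (rule bounded_op_pointwise_matrix[where \<phi> = "\<lambda>y. y" and k = "\<lambda>i j _. M i j"])
  show "\<exists>C\<ge>0. \<forall>G\<in>borel_measurable N. (\<integral>\<^sup>+t. ennreal ((M i j)\<^sup>2) * G t \<partial>N) \<le> ennreal C * integral\<^sup>N N G" for i j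
    by (auto simp: nn_integral_cmult intro!: exI[of _ "(M i j)\<^sup>2"])
qed (auto simp: mat_vec_def)

lemma bounded_op_multiplier:
  assumes N: "finite_measure N"
    and K: "\<And>i j. i < m \<Longrightarrow> j < n \<Longrightarrow> (\<lambda>x. K x i j) \<in> Linf A"
  shows "bounded_op (L2vec n (A \<Otimes>\<^sub>M N)) (L2vec m (A \<Otimes>\<^sub>M N)) (\<lambda>u (x, y). mat_vec n (K x) (u (x, y)))"
proof (rule bounded_op_pointwise_matrix[where \<phi> = "\<lambda>z. z" and k = "\<lambda>i j z. K (fst z) i j"])
  interpret N: finite_measure N by fact
  fix i j assume ij: "i < m" "j < n"
  have [measurable]: "(\<lambda>x. K x i j) \<in> borel_measurable A"
    using K[OF ij] by (simp add: Linf_def)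
  show "(\<lambda>z. K (fst z) i j) \<in> borel_measurable (A \<Otimes>\<^sub>M N)" by measurable
  obtain c where c: "AE x in A. \<bar>K x i j\<bar> \<le> c"
    using K[OF ij] by (auto simp: Linf_def)
  show "\<exists>C\<ge>0. \<forall>G\<in>borel_measurable (A \<Otimes>\<^sub>M N).
      (\<integral>\<^sup>+t. ennreal ((K (fst t) i j)\<^sup>2) * G t \<partial>(A \<Otimes>\<^sub>M N)) \<le> ennreal C * integral\<^sup>N (A \<Otimes>\<^sub>M N) G"
  proof (intro exI[of _ "c\<^sup>2"] conjI ballI)
    fix G :: "_ \<Rightarrow> ennreal" assume [measurable]: "G \<in> borel_measurable (A \<Otimes>\<^sub>M N)"
    have "(\<integral>\<^sup>+t. ennreal ((K (fst t) i j)\<^sup>2) * G t \<partial>(A \<Otimes>\<^sub>M N))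
        = (\<integral>\<^sup>+x. ennreal ((K x i j)\<^sup>2) * (\<integral>\<^sup>+y. G (x, y) \<partial>N) \<partial>A)"
      by (subst N.nn_integral_fst[symmetric]) (auto intro!: nn_integral_cong nn_integral_cmult)
    also have "\<dots> \<le> (\<integral>\<^sup>+x. ennreal (c\<^sup>2) * (\<integral>\<^sup>+y. G (x, y) \<partial>N) \<partial>A)"
      using c by (intro nn_integral_mono_AE, eventually_elim)
        (auto intro!: mult_right_mono ennreal_leI simp: abs_le_square_iff[symmetric])
    also have "\<dots> = ennreal (c\<^sup>2) * integral\<^sup>N (A \<Otimes>\<^sub>M N) G"
      by (simp add: nn_integral_cmult N.nn_integral_fst)
    finally show "(\<integral>\<^sup>+t. ennreal ((K (fst t) i j)\<^sup>2) * G t \<partial>(A \<Otimes>\<^sub>M N))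
        \<le> ennreal (c\<^sup>2) * integral\<^sup>N (A \<Otimes>\<^sub>M N) G" .
  qed simp
qed (auto simp: mat_vec_def)

lemma bounded_op_tensor:
  assumes N: "finite_measure N"
    and K: "\<And>i j. i < m \<Longrightarrow> j < n \<Longrightarrow> (\<lambda>x. K x i j) \<in> L2 A"
  shows "bounded_op (L2vec n N) (L2vec m (A \<Otimes>\<^sub>M N)) (\<lambda>u (x, y). mat_vec n (K x) (u y))"
proof (rule bounded_op_pointwise_matrix[where \<phi> = snd and k = "\<lambda>i j z. K (fst z) i j"])
  fix i j assume ij: "i < m" "j < n"
  have [measurable]: "(\<lambda>x. K x i j) \<in> borel_measurable A"
    using K[OF ij] by (simp add: L2_def)
  show "(\<lambda>z. K (fst z) i j) \<in> borel_measurable (A \<Otimes>\<^sub>M N)" by measurable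
  show "\<exists>C\<ge>0. \<forall>G\<in>borel_measurable N.
      (\<integral>\<^sup>+t. ennreal ((K (fst t) i j)\<^sup>2) * G (snd t) \<partial>(A \<Otimes>\<^sub>M N)) \<le> ennreal C * integral\<^sup>N N G"
    using nn_integral_product[OF sigma_finite_if_finite[OF N], of "\<lambda>x. ennreal ((K x i j)\<^sup>2)"]
      L2_nn_integral[OF K[OF ij]]
    by (intro exI[of _ "LINT x|A. (K x i j)\<^sup>2"]) auto
qed (auto simp: mat_vec_def)

lemma bounded_op_fibre_integral:
  assumes A: "finite_measure A" and N: "finite_measure N"
    and K: "\<And>i j. i < m \<Longrightarrow> j < n \<Longrightarrow> (\<lambda>x. K x i j) \<in> L2 A"
  shows "bounded_op (L2vec n (A \<Otimes>\<^sub>M N)) (L2vec m N) (\<lambda>u y i. LINT x|A. mat_vec n (K x) (u (x, y)) i)"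
proof (rule bounded_op_integral_matrix[where \<phi> = "\<lambda>z. (snd z, fst z)" and k = "\<lambda>i j z. K (snd z) i j",
      OF sigma_finite_if_finite[OF A]])
  interpret A: finite_measure A by fact
  fix i j assume ij: "i < m" "j < n"
  have [measurable]: "(\<lambda>x. K x i j) \<in> borel_measurable A"
    using K[OF ij] by (simp add: L2_def)
  show "(\<lambda>z. K (snd z) i j) \<in> borel_measurable (N \<Otimes>\<^sub>M A)" by measurable
  show "\<exists>C\<ge>0. \<forall>G\<in>borel_measurable (A \<Otimes>\<^sub>M N).
      (\<integral>\<^sup>+t. (\<integral>\<^sup>+\<theta>. ennreal ((K (snd (t, \<theta>)) i j)\<^sup>2) \<partial>A) * (\<integral>\<^sup>+\<theta>. G (snd (t, \<theta>), fst (t, \<theta>)) \<partial>A) \<partial>N)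
        \<le> ennreal C * integral\<^sup>N (A \<Otimes>\<^sub>M N) G"
    using nn_integral_iterated_swap[OF sigma_finite_if_finite[OF A] sigma_finite_if_finite[OF N]]
    by (intro exI[of _ "LINT x|A. (K x i j)\<^sup>2"])
      (auto simp: L2_nn_integral[OF K[OF ij]] nn_integral_cmult)
qed (auto simp: mat_vec_def)

text \<open>
  The factor \<open>s\<close> of the kernel is the cut-off that a variable limit of integration produces.  After it
  has been estimated by 1, the double integral over \<open>(x, y)\<close> splits into \<open>\<integral>\<integral>K\<^sup>2\<close> and the integral of \<open>G\<close>,
  because the first inner integral depends on \<open>x\<close> alone and the second on \<open>y\<close> alone.
\<close>
lemma bounded_op_hilbert_schmidt:
  fixes A :: "'a measure" and N :: "'b measure"
  assumes A: "finite_measure A" and N: "finite_measure N"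
    and s[measurable]: "s \<in> borel_measurable (A \<Otimes>\<^sub>M A)" and s1: "\<And>z. \<bar>s z\<bar> \<le> (1::real)"
    and K: "\<And>i j. i < m \<Longrightarrow> j < n \<Longrightarrow> (\<lambda>(x, \<theta>). K x \<theta> i j) \<in> L2 (A \<Otimes>\<^sub>M A)"
    and F: "\<And>u x y i. x \<in> space A \<Longrightarrow> F u (x, y) i = (LINT \<theta>|A. s (x, \<theta>) * mat_vec n (K x \<theta>) (u (\<theta>, y)) i)"
  shows "bounded_op (L2vec n (A \<Otimes>\<^sub>M N)) (L2vec m (A \<Otimes>\<^sub>M N)) F"
proof (rule bounded_op_integral_matrix[where \<phi> = "\<lambda>z. (snd z, snd (fst z))"
      and k = "\<lambda>i j z. s (fst (fst z), snd z) * K (fst (fst z)) (snd z) i j", OF sigma_finite_if_finite[OF A]])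
  interpret A: finite_measure A by fact
  interpret N: finite_measure N by fact
  fix i j assume ij: "i < m" "j < n"
  have K'[measurable]: "(\<lambda>z. K (fst z) (snd z) i j) \<in> borel_measurable (A \<Otimes>\<^sub>M A)"
    using K[OF ij] by (simp add: L2_def case_prod_beta')
  have *[measurable]: "(\<lambda>z. K (fst (fst z)) (snd z) i j) \<in> borel_measurable ((A \<Otimes>\<^sub>M N) \<Otimes>\<^sub>M A)"
    using measurable_compose[OF _ K', of "\<lambda>z. (fst (fst z), snd z)" "(A \<Otimes>\<^sub>M N) \<Otimes>\<^sub>M A"] by simp
  show "(\<lambda>z. s (fst (fst z), snd z) * K (fst (fst z)) (snd z) i j)
      \<in> borel_measurable ((A \<Otimes>\<^sub>M N) \<Otimes>\<^sub>M A)" by measurable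
  let ?C = "LINT z|(A \<Otimes>\<^sub>M A). (K (fst z) (snd z) i j)\<^sup>2"
  have C: "(\<integral>\<^sup>+x. \<integral>\<^sup>+\<theta>. ennreal ((K x \<theta> i j)\<^sup>2) \<partial>A \<partial>A) = ennreal ?C"
  proof -
    have "(\<integral>\<^sup>+x. \<integral>\<^sup>+\<theta>. ennreal ((K x \<theta> i j)\<^sup>2) \<partial>A \<partial>A)
        = (\<integral>\<^sup>+z. ennreal ((K (fst z) (snd z) i j)\<^sup>2) \<partial>(A \<Otimes>\<^sub>M A))"
      by (subst A.nn_integral_fst[symmetric]) auto
    then show ?thesis
      using L2_nn_integral[OF K[OF ij]] by (simp add: case_prod_beta')
  qed
  show "\<exists>C\<ge>0. \<forall>G\<in>borel_measurable (A \<Otimes>\<^sub>M N).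
      (\<integral>\<^sup>+t. (\<integral>\<^sup>+\<theta>. ennreal ((s (fst (fst (t, \<theta>)), snd (t, \<theta>)) * K (fst (fst (t, \<theta>))) (snd (t, \<theta>)) i j)\<^sup>2) \<partial>A)
          * (\<integral>\<^sup>+\<theta>. G (snd (t, \<theta>), snd (fst (t, \<theta>))) \<partial>A) \<partial>(A \<Otimes>\<^sub>M N))
        \<le> ennreal C * integral\<^sup>N (A \<Otimes>\<^sub>M N) G"
  proof (intro exI[of _ ?C] conjI ballI)
    fix G :: "_ \<Rightarrow> ennreal" assume [measurable]: "G \<in> borel_measurable (A \<Otimes>\<^sub>M N)"
    \<comment> \<open>The cut-off can only decrease the kernel.\<close>
    have le: "ennreal ((s z * r)\<^sup>2) \<le> ennreal (r\<^sup>2)" for z r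
      using s1[of z] mult_right_mono[of "(s z)\<^sup>2" 1 "r\<^sup>2"]
      by (intro ennreal_leI) (simp add: power_mult_distrib abs_square_le_1)
    have "(\<integral>\<^sup>+t. (\<integral>\<^sup>+\<theta>. ennreal ((s (fst t, \<theta>) * K (fst t) \<theta> i j)\<^sup>2) \<partial>A)
          * (\<integral>\<^sup>+\<theta>. G (\<theta>, snd t) \<partial>A) \<partial>(A \<Otimes>\<^sub>M N))
       \<le> (\<integral>\<^sup>+t. (\<integral>\<^sup>+\<theta>. ennreal ((K (fst t) \<theta> i j)\<^sup>2) \<partial>A) * (\<integral>\<^sup>+\<theta>. G (\<theta>, snd t) \<partial>A) \<partial>(A \<Otimes>\<^sub>M N))"
      by (intro nn_integral_mono mult_right_mono le) auto
    also have "\<dots> = (\<integral>\<^sup>+x. \<integral>\<^sup>+\<theta>. ennreal ((K x \<theta> i j)\<^sup>2) \<partial>A \<partial>A) * (\<integral>\<^sup>+y. \<integral>\<^sup>+\<theta>. G (\<theta>, y) \<partial>A \<partial>N)"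
    proof (rule nn_integral_product[OF sigma_finite_if_finite[OF N]])
      have "(\<lambda>z. ennreal ((K (fst z) (snd z) i j)\<^sup>2)) \<in> borel_measurable (A \<Otimes>\<^sub>M A)" by measurable
      from A.borel_measurable_nn_integral_fst[OF this]
      show "(\<lambda>x. \<integral>\<^sup>+\<theta>. ennreal ((K x \<theta> i j)\<^sup>2) \<partial>A) \<in> borel_measurable A" by simp
    qed measurable
    also have "\<dots> = ennreal ?C * integral\<^sup>N (A \<Otimes>\<^sub>M N) G"
      by (simp add: C nn_integral_iterated_swap sigma_finite_if_finite A N)
    finally show "(\<integral>\<^sup>+t. (\<integral>\<^sup>+\<theta>. ennreal ((s (fst (fst (t, \<theta>)), snd (t, \<theta>)) * K (fst (fst (t, \<theta>))) (snd (t, \<theta>)) i j)\<^sup>2) \<partial>A)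
          * (\<integral>\<^sup>+\<theta>. G (snd (t, \<theta>), snd (fst (t, \<theta>))) \<partial>A) \<partial>(A \<Otimes>\<^sub>M N))
        \<le> ennreal ?C * integral\<^sup>N (A \<Otimes>\<^sub>M N) G"
      by simp
  qed simp
next
  show "F u t i = (LINT \<theta>|A. (\<Sum>j<n. (s (fst (fst (t, \<theta>)), snd (t, \<theta>)) * K (fst (fst (t, \<theta>))) (snd (t, \<theta>)) i j)
      * u (snd (t, \<theta>), snd (fst (t, \<theta>))) j))" if "t \<in> space (A \<Otimes>\<^sub>M N)" for u t i
    using F[of "fst t" u "snd t" i] that
    by (simp add: space_pair_measure mem_Times_iff mat_vec_def sum_distrib_left mult.assoc)
qed measurable

lemma pi4_map_eq:
  "pi4_map a b (n0, n1) P u =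
     ((\<lambda>i. mat_vec n0 (B00 P) (fst u) i
         + (LINT x:{a..b}|lborel. mat_vec n1 (B01 P x) (snd u x) i)),
      (\<lambda>x i. mat_vec n0 (B10 P x) (fst u) i
         + mat_vec n1 (R0 P x) (snd u x) i
         + (LINT \<theta>:{a..x}|lborel. mat_vec n1 (R1 P x \<theta>) (snd u \<theta>) i)
         + (LINT \<theta>:{x..b}|lborel. mat_vec n1 (R2 P x \<theta>) (snd u \<theta>) i)))"
  by (cases u) simp

text \<open>
  Each of the six terms of a 4-PI operator is one of the elementary operators above, applied in \<open>x\<close> and
  with \<open>y\<close> as a parameter.
\<close>
lemma bounded_op_4PI_multiplier:
  assumes "is_4PI a b (n0, n1) (m0, m1) F" and N: "finite_measure N"
  shows "bounded_op (rl_field_space (leb a b) N n0 n1) (rl_field_space (leb a b) N m0 m1) (\<lambda>p y. F (p y))"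
proof -
  obtain P where P: "pi4_ok a b (n0, n1) (m0, m1) P" and F: "F = pi4_map a b (n0, n1) P"
    using assms(1) by (auto simp: is_4PI_def)
  let ?X = "rl_field_space (leb a b) N n0 n1"
  note A = finite_measure_leb[of a b]
  note fin = A N
  have 1: "bounded_op ?X (L2vec m0 N) (\<lambda>p y. mat_vec n0 (B00 P) (fst (p y)))"
    by (rule bounded_op_rl_field_from_component(1)[OF sqspace_L2vec bounded_op_const_matrix])
  have 2: "bounded_op ?X (L2vec m0 N) (\<lambda>p y i. LINT x:{a..b}|lborel. mat_vec n1 (B01 P x) (snd (p y) x) i)"
    using bounded_op_rl_field_from_component(2)[OF sqspace_L2vec bounded_op_fibre_integral[OF fin, of m0 n1 "B01 P"]] P
    by (simp add: LINT_leb)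
  have 3: "bounded_op ?X (L2vec m1 (leb a b \<Otimes>\<^sub>M N)) (\<lambda>p (x, y). mat_vec n0 (B10 P x) (fst (p y)))"
    using bounded_op_rl_field_from_component(1)[OF sqspace_L2vec bounded_op_tensor[OF N, of m1 n0 "B10 P"]] P by simp
  have 4: "bounded_op ?X (L2vec m1 (leb a b \<Otimes>\<^sub>M N)) (\<lambda>p (x, y). mat_vec n1 (R0 P x) (snd (p y) x))"
    using bounded_op_rl_field_from_component(2)[OF sqspace_L2vec bounded_op_multiplier[OF N, of m1 n1 "R0 P"]] P by simp
  have "bounded_op (L2vec n1 (leb a b \<Otimes>\<^sub>M N)) (L2vec m1 (leb a b \<Otimes>\<^sub>M N))
      (\<lambda>u (x, y) i. LINT \<theta>:{a..x}|lborel. mat_vec n1 (R1 P x \<theta>) (u (\<theta>, y)) i)"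
    by (rule bounded_op_hilbert_schmidt[OF fin, where s = "\<lambda>(x, \<theta>). if \<theta> \<le> x then 1 else 0" and K = "R1 P"])
      (use P in \<open>auto simp: LINT_leb_lower space_leb intro!: Bochner_Integration.integral_cong\<close>)
  from bounded_op_rl_field_from_component(2)[OF sqspace_L2vec this]
  have 5: "bounded_op ?X (L2vec m1 (leb a b \<Otimes>\<^sub>M N))
      (\<lambda>p (x, y) i. LINT \<theta>:{a..x}|lborel. mat_vec n1 (R1 P x \<theta>) (snd (p y) \<theta>) i)" by simp
  have "bounded_op (L2vec n1 (leb a b \<Otimes>\<^sub>M N)) (L2vec m1 (leb a b \<Otimes>\<^sub>M N))
      (\<lambda>u (x, y) i. LINT \<theta>:{x..b}|lborel. mat_vec n1 (R2 P x \<theta>) (u (\<theta>, y)) i)"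
    by (rule bounded_op_hilbert_schmidt[OF fin, where s = "\<lambda>(x, \<theta>). if x \<le> \<theta> then 1 else 0" and K = "R2 P"])
      (use P in \<open>auto simp: LINT_leb_upper space_leb intro!: Bochner_Integration.integral_cong\<close>)
  from bounded_op_rl_field_from_component(2)[OF sqspace_L2vec this]
  have 6: "bounded_op ?X (L2vec m1 (leb a b \<Otimes>\<^sub>M N))
      (\<lambda>p (x, y) i. LINT \<theta>:{x..b}|lborel. mat_vec n1 (R2 P x \<theta>) (snd (p y) \<theta>) i)" by simp
  note add = bounded_op_add[OF sqspace_rl_field sqspace_L2vec]
  show ?thesis
    using add[OF 1 2] add[OF add[OF add[OF 3 4] 5] 6]
    by (intro bounded_op_rl_fieldI sqspace_rl_field) (simp_all add: F pi4_map_eq plus_fun_def case_prod_beta')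
qed

lemma rl_integral_const: "rl_integral {0..1} (\<lambda>y. u) = u"
  by (simp add: rl_integral_def LINT_leb space_leb)

text \<open>
  A single element is a constant family over the unit interval, and a constant family is recovered from
  its integral; so the parametric version contains this one.
\<close>
lemma bounded_op_4PI:
  assumes "is_4PI a b (n0, n1) (m0, m1) F"
  shows "bounded_op (rl_space (leb a b) n0 n1) (rl_space (leb a b) m0 m1) F"
proof -
  have "bounded_op (rl_space (leb a b) n0 n1) (rl_space (leb a b) m0 m1) (\<lambda>u. rl_integral {0..1} (\<lambda>y. F u))"
    by (rule bounded_op_comp[OF sqspace_rl sqspace_rl_field sqspace_rl _ bounded_op_rl_integral])
      (rule bounded_op_comp[OF sqspace_rl sqspace_rl_field sqspace_rl_field bounded_op_const[OF finite_measure_leb]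
          bounded_op_4PI_multiplier[OF assms finite_measure_leb]])
  then show ?thesis by (simp add: rl_integral_const)
qed

section \<open>PI operators are bounded\<close>

definition Zsqspace :: "real \<Rightarrow> real \<Rightarrow> real \<Rightarrow> real \<Rightarrow> dim4 \<Rightarrow> zfun sqspace" where
  "Zsqspace a b c d = (\<lambda>(n0, n1, n2, n3).
     sqjoin fst (rl_space (leb a b) n0 n1) snd (rl_field_space (leb a b) (leb c d) n2 n3))"

lemma linear_fst_snd: "linear (fst :: 'a::real_vector \<times> 'b::real_vector \<Rightarrow> 'a)"
  "linear (snd :: 'a::real_vector \<times> 'b::real_vector \<Rightarrow> 'b)"
  by (auto intro!: linearI)

lemma sqspace_Zsqspace: "sqspace (Zsqspace a b c d n)"
  unfolding Zsqspace_def by (cases n) (auto intro!: sqspace_sqjoin linear_fst_snd sqspace_rl sqspace_rl_field)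

text \<open>
  The main analytic fact: a PI operator is a sum of compositions of 4-PI operators, constant
  extension, and total or partial integration in \<open>y\<close>, all of which are bounded.
\<close>
lemma bounded_op_PI:
  assumes "is_PI a b c d n m F"
  shows "bounded_op (Zsqspace a b c d n) (Zsqspace a b c d m) F"
proof -
  obtain n0 n1 n2 n3 m0 m1 m2 m3 where n: "n = (n0, n1, n2, n3)" and m: "m = (m0, m1, m2, m3)"
    by (metis prod_cases4)
  obtain B11 B12 B21 N0 N1 N2 where
    B: "is_4PI a b (n0, n1) (m0, m1) B11" "is_4PI a b (n2, n3) (m0, m1) B12"
      "is_4PI a b (n0, n1) (m2, m3) B21" and
    N: "is_4PI a b (n2, n3) (m2, m3) N0" "is_4PI a b (n2, n3) (m2, m3) N1"
      "is_4PI a b (n2, n3) (m2, m3) N2" and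
    F: "F = (\<lambda>(p1, p2).
               (B11 p1 + rl_integral {c..d} (\<lambda>y. B12 (p2 y)),
                \<lambda>y. B21 p1 + N0 (p2 y)
                    + rl_integral {c..y} (\<lambda>\<nu>. N1 (p2 \<nu>))
                    + rl_integral {y..d} (\<lambda>\<nu>. N2 (p2 \<nu>))))"
    using assms unfolding n m is_PI.simps by blast
  let ?A = "leb a b" and ?C = "leb c d"
  let ?X = "sqjoin fst (rl_space ?A n0 n1) snd (rl_field_space ?A ?C n2 n3)"
  note fin = finite_measure_leb
  have X: "sqspace ?X" and p1: "bounded_op ?X (rl_space ?A n0 n1) fst" and p2: "bounded_op ?X (rl_field_space ?A ?C n2 n3) snd"
    by (rule sqspace_sqjoin bounded_op_sqjoin_projections linear_fst_snd sqspace_rl sqspace_rl_field)+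
  note c0 = bounded_op_comp[OF X _ sqspace_rl] and c1 = bounded_op_comp[OF X _ sqspace_rl_field]
  note mult = bounded_op_4PI_multiplier[OF _ fin]
  have 1: "bounded_op ?X (rl_space ?A m0 m1) (\<lambda>p. B11 (fst p))"
    by (rule c0[OF sqspace_rl p1 bounded_op_4PI[OF B(1)]])
  have 2: "bounded_op ?X (rl_space ?A m0 m1) (\<lambda>p. rl_integral {c..d} (\<lambda>y. B12 (snd p y)))"
    by (rule c0[OF sqspace_rl_field c1[OF sqspace_rl_field p2 mult[OF B(2)]] bounded_op_rl_integral])
  have 3: "bounded_op ?X (rl_field_space ?A ?C m2 m3) (\<lambda>p y. B21 (fst p))"
    by (rule c1[OF sqspace_rl c0[OF sqspace_rl p1 bounded_op_4PI[OF B(3)]] bounded_op_const[OF fin]])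
  have 4: "bounded_op ?X (rl_field_space ?A ?C m2 m3) (\<lambda>p y. N0 (snd p y))"
    by (rule c1[OF sqspace_rl_field p2 mult[OF N(1)]])
  have 5: "bounded_op ?X (rl_field_space ?A ?C m2 m3) (\<lambda>p y. rl_integral {c..y} (\<lambda>\<nu>. N1 (snd p \<nu>)))"
    by (rule c1[OF sqspace_rl_field c1[OF sqspace_rl_field p2 mult[OF N(2)]] bounded_op_partial_rl_integral(1)])
  have 6: "bounded_op ?X (rl_field_space ?A ?C m2 m3) (\<lambda>p y. rl_integral {y..d} (\<lambda>\<nu>. N2 (snd p \<nu>)))"
    by (rule c1[OF sqspace_rl_field c1[OF sqspace_rl_field p2 mult[OF N(3)]] bounded_op_partial_rl_integral(2)])
  note add = bounded_op_add[OF X sqspace_rl_field]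
  have "bounded_op ?X (sqjoin fst (rl_space ?A m0 m1) snd (rl_field_space ?A ?C m2 m3)) F"
  proof (rule bounded_op_sqjoinI[OF linear_fst_snd X sqspace_rl sqspace_rl_field])
    show "bounded_op ?X (rl_space ?A m0 m1) (\<lambda>p. fst (F p))"
      using bounded_op_add[OF X sqspace_rl 1 2] by (simp add: F case_prod_beta')
    show "bounded_op ?X (rl_field_space ?A ?C m2 m3) (\<lambda>p. snd (F p))"
      using add[OF add[OF add[OF 3 4] 5] 6] by (simp add: F case_prod_beta' plus_fun_def)
  qed
  then show ?thesis by (simp add: Zsqspace_def n m)
qed

lemma carr_Zspace: "carr (Zsqspace a b c d n) = Zspace a b c d n"
  by (cases n) (auto simp: Zsqspace_def sqjoin_def rl_space_def rl_field_space_def L2vec_def L2_def case_prod_beta'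
      finite_measure.integrable_const[OF finite_measure_leb])

lemma sqnorm_Zspace: "sqnorm (Zsqspace a b c d n) p = (znorm a b c d n p)\<^sup>2"
proof (cases n)
  case (fields n0 n1 n2 n3)
  then show ?thesis
    by (cases p; cases "fst p")
      (auto simp: Zsqspace_def sqjoin_def rl_space_def rl_field_space_def L2vec_def case_prod_beta' space_leb add.assoc
        sum_nonneg add_nonneg_nonneg integral_nonneg)
qed

text \<open>
  Square integrable functions agree almost everywhere if and only if the integral of the square of
  their difference vanishes; without square integrability that integral could be 0 by default.
\<close>
lemma zeq_iff_eqv:
  assumes "p \<in> Zspace a b c d n" "q \<in> Zspace a b c d n"
  shows "zeq a b c d n p q \<longleftrightarrow> eqv (Zsqspace a b c d n) p q"
proof (cases n)
  case (fields n0 n1 n2 n3)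
  obtain u0 u1 p2 v0 v1 q2 where pq: "p = ((u0, u1), p2)" "q = ((v0, v1), q2)"
    by (metis surj_pair)
  have AE: "(AE x in leb 0 1. P) \<longleftrightarrow> P" for P
  proof (cases P)
    case False
    have eq: "{x \<in> space (leb 0 1). \<not> P} = space (leb 0 1)" using False by auto
    have "emeasure (leb 0 1) (space (leb 0 1)) = 1" by (simp add: space_leb)
    then show ?thesis
      using AE_iff_measurable[OF sets.top eq] False by simp
  qed simp
  note iffs = eqv_sqjoin_iff[OF linear_fst_snd sqspace_rl sqspace_rl_field]
    eqv_sqjoin_iff[OF linear_rl_components sqspace_L2vec sqspace_L2vec] eqv_sqjoin_iff[OF linear_rl_field_components sqspace_L2vec sqspace_L2vec]
  have "eqv (Zsqspace a b c d n) p q \<longleftrightarrow>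
      (eqv (L2vec n0 (leb 0 1)) (\<lambda>t. u0) (\<lambda>t. v0) \<and> eqv (L2vec n1 (leb a b)) u1 v1) \<and>
      eqv (L2vec n2 (leb c d)) (\<lambda>y. fst (p2 y)) (\<lambda>y. fst (q2 y)) \<and>
      eqv (L2vec n3 (leb a b \<Otimes>\<^sub>M leb c d)) (\<lambda>(x, y). snd (p2 y) x) (\<lambda>(x, y). snd (q2 y) x)"
    unfolding fields pq Zsqspace_def prod.case iffs(1) fst_conv snd_conv
    unfolding rl_space_def rl_field_space_def iffs(2,3) by simp
  then show ?thesis
    using assms unfolding fields pq
    by (auto simp: eqv_L2vec_iff AE carr_L2vec case_prod_beta' L2_def
        finite_measure.integrable_const[OF finite_measure_leb])
qed

lemma zscale_eq: "zscale k p = k *\<^sub>R p"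
  by (auto simp: zscale_def rl_scale_def scaleR_fun_def scaleR_prod_def)

lemma zderiv_iff_sqderiv: "zderiv a b c d n x x' t \<longleftrightarrow> sqderiv (Zsqspace a b c d n) x x' t"
proof -
  have "(\<lambda>s. sqnorm (Zsqspace a b c d n) (x s - x t - (s - t) *\<^sub>R x') / (s - t)\<^sup>2)
      = (\<lambda>s. (znorm a b c d n (x s - x t - zscale (s - t) x') / \<bar>s - t\<bar>)\<^sup>2)"
    by (simp add: sqnorm_Zspace zscale_eq power_divide)
  then show ?thesis
    unfolding zderiv_def sqderiv_def carr_Zspace by simp
qed

section \<open>Concatenation of states\<close>

lemma all_less_add_iff: "(\<forall>i<n + m. P i) \<longleftrightarrow> (\<forall>i<n. P i) \<and> (\<forall>i<m. P (n + i))" for n m :: nat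
  by (metis add_less_cancel_left le_add_diff_inverse not_le_imp_less trans_less_add1)

lemma sum_lessThan_add: "(\<Sum>i<n + m. f i) = (\<Sum>i<n. f i) + (\<Sum>i<m. f (n + i))"
  for f :: "nat \<Rightarrow> real"
  by (induction m) (simp_all add: add.assoc)

lemma L2vec_append:
  "(\<lambda>x. vec_append n (f x) (g x)) \<in> carr (L2vec (n + m) M) \<longleftrightarrow> f \<in> carr (L2vec n M) \<and> g \<in> carr (L2vec m M)"
  "sqnorm (L2vec (n + m) M) (\<lambda>x. vec_append n (f x) (g x)) = sqnorm (L2vec n M) f + sqnorm (L2vec m M) g"
  by (simp_all add: carr_L2vec sqnorm_L2vec all_less_add_iff sum_lessThan_add vec_append_def)

lemma zappend_eq:
  "zappend (n0, n1, n2, n3) p q =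
     ((vec_append n0 (fst (fst p)) (fst (fst q)), \<lambda>x. vec_append n1 (snd (fst p) x) (snd (fst q) x)),
      \<lambda>y. (vec_append n2 (fst (snd p y)) (fst (snd q y)),
           \<lambda>x. vec_append n3 (snd (snd p y) x) (snd (snd q y) x)))"
  by (metis prod.collapse zappend.simps)

lemma ztake_eq:
  "ztake (n0, n1, n2, n3) p = ((vec_take n0 (fst (fst p)), \<lambda>x. vec_take n1 (snd (fst p) x)),
     \<lambda>y. (vec_take n2 (fst (snd p y)), \<lambda>x. vec_take n3 (snd (snd p y) x)))"
  by (metis prod.collapse ztake.simps)

lemma zdrop_eq:
  "zdrop (n0, n1, n2, n3) p = ((vec_drop n0 (fst (fst p)), \<lambda>x. vec_drop n1 (snd (fst p) x)),
     \<lambda>y. (vec_drop n2 (fst (snd p y)), \<lambda>x. vec_drop n3 (snd (snd p y) x)))"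
  by (metis prod.collapse zdrop.simps)

text \<open>
  The identification of $\mathrm{Z}^n\times\mathrm{Z}^m$ with $\mathrm{Z}^{n+m}$ is isometric.
\<close>
lemma zappend_carr_sqnorm:
  "zappend n p q \<in> carr (Zsqspace a b c d (n + m)) \<longleftrightarrow> p \<in> carr (Zsqspace a b c d n) \<and> q \<in> carr (Zsqspace a b c d m)"
  "sqnorm (Zsqspace a b c d (n + m)) (zappend n p q) = sqnorm (Zsqspace a b c d n) p + sqnorm (Zsqspace a b c d m) q"
proof -
  obtain n0 n1 n2 n3 m0 m1 m2 m3 where nm: "n = (n0, n1, n2, n3)" "m = (m0, m1, m2, m3)"
    by (metis prod_cases4)
  show "zappend n p q \<in> carr (Zsqspace a b c d (n + m)) \<longleftrightarrow> p \<in> carr (Zsqspace a b c d n) \<and> q \<in> carr (Zsqspace a b c d m)"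
    "sqnorm (Zsqspace a b c d (n + m)) (zappend n p q) = sqnorm (Zsqspace a b c d n) p + sqnorm (Zsqspace a b c d m) q"
    unfolding nm by (auto simp: zappend_eq Zsqspace_def sqjoin_def rl_space_def rl_field_space_def case_prod_beta' L2vec_append)
qed

lemma zappend_linear:
  "zappend n p q + zappend n p' q' = zappend n (p + p') (q + q')"
  "zappend n p q - zappend n p' q' = zappend n (p - p') (q - q')"
  "k *\<^sub>R zappend n p q = zappend n (k *\<^sub>R p) (k *\<^sub>R q)"
proof -
  obtain n0 n1 n2 n3 where n: "n = (n0, n1, n2, n3)" by (metis prod_cases4)
  show "zappend n p q + zappend n p' q' = zappend n (p + p') (q + q')"
    unfolding n zappend_eq by (auto simp: vec_append_def prod_eq_iff fun_eq_iff scaleR_fun_def)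
  show "zappend n p q - zappend n p' q' = zappend n (p - p') (q - q')"
    unfolding n zappend_eq by (auto simp: vec_append_def prod_eq_iff fun_eq_iff scaleR_fun_def)
  show "k *\<^sub>R zappend n p q = zappend n (k *\<^sub>R p) (k *\<^sub>R q)"
    unfolding n zappend_eq by (auto simp: vec_append_def prod_eq_iff fun_eq_iff scaleR_fun_def)
qed

lemma zappend_take_drop: "zappend n (ztake n x) (zdrop n x) = x"
proof -
  obtain n0 n1 n2 n3 where n: "n = (n0, n1, n2, n3)" by (metis prod_cases4)
  have "vec_append k (vec_take k u) (vec_drop k u) = u" for k u
    by (auto simp: vec_append_def vec_take_def vec_drop_def)
  then show ?thesis unfolding n zappend_eq ztake_eq zdrop_eq by simp
qed

lemma zdrop_zappend: "zdrop n (zappend n p q) = q"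
proof -
  obtain n0 n1 n2 n3 where n: "n = (n0, n1, n2, n3)" by (metis prod_cases4)
  have "vec_drop k (vec_append k u v) = v" for k u v
    by (auto simp: vec_append_def vec_drop_def)
  then show ?thesis unfolding n zappend_eq zdrop_eq by simp
qed

lemma eqv_zappend_iff:
  "eqv (Zsqspace a b c d (n + m)) (zappend n p q) (zappend n p' q') \<longleftrightarrow>
   eqv (Zsqspace a b c d n) p p' \<and> eqv (Zsqspace a b c d m) q q'"
proof -
  have "0 \<le> sqnorm (Zsqspace a b c d k) x" for k x by (simp add: sqnorm_Zspace)
  then show ?thesis
    by (auto simp: eqv_def zappend_linear zappend_carr_sqnorm add_nonneg_eq_0_iff)
qed

text \<open>
  Not an equation of functions: \<open>ztake\<close> replaces the entries of \<open>p\<close> beyond the dimension by 0.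
\<close>
lemma ztake_zappend:
  assumes "p \<in> carr (Zsqspace a b c d n)" "q \<in> carr (Zsqspace a b c d m)"
  shows "eqv (Zsqspace a b c d n) (ztake n (zappend n p q)) p"
proof -
  have "eqv (Zsqspace a b c d (n + m)) (zappend n (ztake n (zappend n p q)) (zdrop n (zappend n p q)))
    (zappend n p q)"
    unfolding zappend_take_drop using assms by (intro eqv_refl sqspace_Zsqspace) (simp add: zappend_carr_sqnorm)
  then show ?thesis by (simp add: eqv_zappend_iff)
qed

text \<open>
  The remainder of the joint curve has as its squared seminorm the sum of those of the two remainders,
  and both are nonnegative.
\<close>
lemma sqderiv_zappend_iff:
  assumes "0 \<le> t" and x: "\<And>s. 0 \<le> s \<Longrightarrow> x s \<in> carr (Zsqspace a b c d n)" 
    and y: "\<And>s. 0 \<le> s \<Longrightarrow> y s \<in> carr (Zsqspace a b c d m)"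
  shows "sqderiv (Zsqspace a b c d (n + m)) (\<lambda>s. zappend n (x s) (y s)) (zappend n x' y') t
    \<longleftrightarrow> sqderiv (Zsqspace a b c d n) x x' t \<and> sqderiv (Zsqspace a b c d m) y y' t"
    (is "?L \<longleftrightarrow> ?R")
proof
  let ?u = "\<lambda>s. sqnorm (Zsqspace a b c d n) (x s - x t - (s - t) *\<^sub>R x')"
  let ?v = "\<lambda>s. sqnorm (Zsqspace a b c d m) (y s - y t - (s - t) *\<^sub>R y')"
  have eq: "sqnorm (Zsqspace a b c d (n + m)) (zappend n (x s) (y s) - zappend n (x t) (y t) - (s - t) *\<^sub>R zappend n x' y')
      = ?u s + ?v s" for s
    by (simp add: zappend_linear zappend_carr_sqnorm)
  {
    assume L: ?L
    then have lim: "((\<lambda>s. (?u s + ?v s) / (s - t)\<^sup>2) \<longlongrightarrow> 0) (at t within {0..})"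
      and c: "x' \<in> carr (Zsqspace a b c d n)" "y' \<in> carr (Zsqspace a b c d m)"
      by (simp_all add: sqderiv_def eq zappend_carr_sqnorm)
    show ?R
      by (intro conjI sqderiv_dominated[OF c(1) sqspace_Zsqspace assms(1) x lim]
          sqderiv_dominated[OF c(2) sqspace_Zsqspace assms(1) y lim]) (auto simp: sqnorm_Zspace)
  }
  assume ?R
  then show ?L
    using tendsto_add[of "\<lambda>s. ?u s / (s - t)\<^sup>2" 0 _ "\<lambda>s. ?v s / (s - t)\<^sup>2" 0]
    by (simp add: sqderiv_def eq zappend_carr_sqnorm add_divide_distrib)
qed

section \<open>The interconnection\<close>

text \<open>
  Substituting \<open>r = K \<psi> + D (C v + E w)\<close> into \<open>\<T> r + \<W> w + \<V> v\<close> and multiplying out.  The same identity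
  serves for the derivatives, for the right-hand side of the equation and for the output \<open>z\<close>.  The element \<open>v'\<close> stands for the first
  component cut out of the joint state, which is only equivalent to \<open>v\<close>.
\<close>
lemma closed_loop_first:
  assumes X: "sqspace V" "sqspace Q" "sqspace R" "sqspace Y"
    and ops: "bounded_op R Y \<T>" "bounded_op W Y \<W>" "bounded_op V Y \<V>" "bounded_op V Q C" "bounded_op W Q E" "bounded_op P R K" "bounded_op Q R D"
    and el: "v \<in> carr V" "w \<in> carr W" "\<psi> \<in> carr P" "eqv V v' v"
    and r: "eqv R r (K \<psi> + D (C v + E w))"
  shows "eqv Y (\<W> w + \<T> (D (E w)) + (\<V> v' + \<T> (D (C v')) + \<T> (K \<psi>))) (\<T> r + \<W> w + \<V> v)"
proof -
  note tr = eqv_trans[OF X(4)] and sy = eqv_sym[OF X(4)] and add = eqv_add[OF X(4)]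
  have Cv: "C v \<in> carr Q" "E w \<in> carr Q" "K \<psi> \<in> carr R"
    by (rule bounded_op_carr[OF ops(4)] bounded_op_carr[OF ops(5)] bounded_op_carr[OF ops(6)], rule el)+
  have DC: "D (C v) \<in> carr R" "D (E w) \<in> carr R"
    by (rule bounded_op_carr[OF ops(7)], rule Cv)+
  have sum: "C v + E w \<in> carr Q" "K \<psi> + D (C v + E w) \<in> carr R" "D (C v) + D (E w) \<in> carr R"
    using Cv DC bounded_op_carr[OF ops(7)] sqspace_closed(2)[OF X(2)] sqspace_closed(2)[OF X(3)] by blast+
  have "eqv R (K \<psi> + D (C v + E w)) (K \<psi> + (D (C v) + D (E w)))"
    by (intro eqv_add X eqv_refl Cv bounded_op_plus[OF ops(7)])
  from eqv_trans[OF X(3) r this]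
  have "eqv Y (\<T> r) (\<T> (K \<psi> + (D (C v) + D (E w))))"
    by (rule bounded_op_eqv[OF X(3,4) ops(1)])
  from tr[OF this bounded_op_plus[OF ops(1) Cv(3) sum(3)]]
  have "eqv Y (\<T> r) (\<T> (K \<psi>) + \<T> (D (C v) + D (E w)))" .
  from tr[OF this add[OF eqv_refl[OF X(4) bounded_op_carr[OF ops(1) Cv(3)]] bounded_op_plus[OF ops(1) DC]]]
  have T: "eqv Y (\<T> r) (\<T> (K \<psi>) + (\<T> (D (C v)) + \<T> (D (E w))))" .
  have rf: "eqv Y (\<W> w) (\<W> w)" "eqv Y (\<V> v) (\<V> v)" "eqv Y (\<T> (K \<psi>)) (\<T> (K \<psi>))"
    "eqv Y (\<T> (D (E w))) (\<T> (D (E w)))"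
    using eqv_refl[OF X(4)] bounded_op_carr[OF ops(1)] bounded_op_carr[OF ops(2)] bounded_op_carr[OF ops(3)] Cv DC el by blast+
  have TDC: "eqv Y (\<T> (D (C v'))) (\<T> (D (C v)))"
    by (rule bounded_op_eqv[OF X(3,4) ops(1)], rule bounded_op_eqv[OF X(2,3) ops(7)], rule bounded_op_eqv[OF X(1,2) ops(4)], rule el)
  have "eqv Y (\<W> w + \<T> (D (E w)) + (\<V> v' + \<T> (D (C v')) + \<T> (K \<psi>)))
     (\<W> w + \<T> (D (E w)) + (\<V> v + \<T> (D (C v)) + \<T> (K \<psi>)))"
    by (intro add rf TDC bounded_op_eqv[OF X(1,4) ops(3) el(4)])
  also have "\<W> w + \<T> (D (E w)) + (\<V> v + \<T> (D (C v)) + \<T> (K \<psi>))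
    = (\<T> (K \<psi>) + (\<T> (D (C v)) + \<T> (D (E w)))) + \<W> w + \<V> v"
    by (simp add: algebra_simps)
  also (back_subst) 
  have "eqv Y ((\<T> (K \<psi>) + (\<T> (D (C v)) + \<T> (D (E w)))) + \<W> w + \<V> v) (\<T> r + \<W> w + \<V> v)"
    by (intro add rf sy[OF T])
  finally (tr) show ?thesis .
qed

text \<open>
  Substituting \<open>q = C v + E w\<close> into the equation of the second system.
\<close>
lemma closed_loop_second:
  assumes X: "sqspace V" "sqspace Q" "sqspace Y"
    and ops: "bounded_op Q Y B" "bounded_op P Y A" "bounded_op V Q C" "bounded_op W Q E"
    and el: "v \<in> carr V" "w \<in> carr W" "\<psi> \<in> carr P" "eqv V v' v"
    and q: "eqv Q q (C v + E w)"
  shows "eqv Y (B (E w) + (B (C v') + A \<psi>)) (B q + A \<psi>)"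
proof -
  note tr = eqv_trans[OF X(3)] and sy = eqv_sym[OF X(3)] and add = eqv_add[OF X(3)]
  have Cv: "C v \<in> carr Q" "E w \<in> carr Q"
    by (rule bounded_op_carr[OF ops(3)] bounded_op_carr[OF ops(4)], rule el)+
  have rf: "eqv Y (B (E w)) (B (E w))" "eqv Y (A \<psi>) (A \<psi>)"
    using eqv_refl[OF X(3)] bounded_op_carr[OF ops(1)] bounded_op_carr[OF ops(2)] Cv el by blast+
  have "eqv Y (B q) (B (C v) + B (E w))"
    by (rule tr[OF bounded_op_eqv[OF X(2,3) ops(1) q] bounded_op_plus[OF ops(1) Cv]])
  from sy[OF add[OF this rf(2)]]
  have "eqv Y (B (E w) + (B (C v) + A \<psi>)) (B q + A \<psi>)"
    by (simp add: ac_simps)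
  moreover have "eqv Y (B (E w) + (B (C v') + A \<psi>)) (B (E w) + (B (C v) + A \<psi>))"
    by (intro add rf bounded_op_eqv[OF X(2,3) ops(1) bounded_op_eqv[OF X(1,2) ops(3) el(4)]])
  ultimately show ?thesis
    using tr by blast
qed

lemma is_pie_bounded_op:
  assumes "is_pie a b c d nx nw nz G"
  shows "bounded_op (Zsqspace a b c d nx) (Zsqspace a b c d nx) (opT G)" "bounded_op (Zsqspace a b c d nw) (Zsqspace a b c d nx) (opTw G)"
    "bounded_op (Zsqspace a b c d nx) (Zsqspace a b c d nx) (opA G)" "bounded_op (Zsqspace a b c d nw) (Zsqspace a b c d nx) (opBw G)"
    "bounded_op (Zsqspace a b c d nx) (Zsqspace a b c d nz) (opCz G)" "bounded_op (Zsqspace a b c d nw) (Zsqspace a b c d nz) (opD G)"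
  using assms by (simp_all add: is_pie_def bounded_op_PI)

lemma is_pie2_bounded_op:
  assumes "is_pie2 a b c d nv nw nr nz nq G"
  shows "bounded_op (Zsqspace a b c d nr) (Zsqspace a b c d nv) (T1r G)" "bounded_op (Zsqspace a b c d nw) (Zsqspace a b c d nv) (T1w G)"
    "bounded_op (Zsqspace a b c d nv) (Zsqspace a b c d nv) (T1 G)" "bounded_op (Zsqspace a b c d nv) (Zsqspace a b c d nv) (A1 G)"
    "bounded_op (Zsqspace a b c d nw) (Zsqspace a b c d nv) (B1w G)" "bounded_op (Zsqspace a b c d nr) (Zsqspace a b c d nv) (B1r G)"
    "bounded_op (Zsqspace a b c d nv) (Zsqspace a b c d nz) (Cz1 G)" "bounded_op (Zsqspace a b c d nw) (Zsqspace a b c d nz) (Dzw G)"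
    "bounded_op (Zsqspace a b c d nr) (Zsqspace a b c d nz) (Dzr G)" "bounded_op (Zsqspace a b c d nv) (Zsqspace a b c d nq) (Cq1 G)"
    "bounded_op (Zsqspace a b c d nw) (Zsqspace a b c d nq) (Dqw G)"
  using assms by (simp_all add: is_pie2_def bounded_op_PI)

context
  fixes a b c d :: real and n1 n2 nw nz nq nr :: dim4 and G1 :: pie2 and G2 :: pie
    and Z :: "dim4 \<Rightarrow> zfun sqspace" and I :: pie
  assumes G1: "is_pie2 a b c d n1 nw nr nz nq G1" and G2: "is_pie a b c d n2 nq nr G2"
  defines "Z \<equiv> Zsqspace a b c d" and "I \<equiv> interconnection n1 G1 G2"
begin

text \<open>
  Both sides of the equation of the interconnection are, up to \<open>eqv\<close>, the two sides of the given
  systems stacked.  It applies in the same way to the signals and to their derivatives, because these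
  satisfy the same linear relations.
\<close>
lemma interconnection_reduces:
  assumes v: "v \<in> carr (Z n1)" and \<psi>: "\<psi> \<in> carr (Z n2)" and w: "w \<in> carr (Z nw)"
    and q: "eqv (Z nq) q (Cq1 G1 v + Dqw G1 w)"
    and r: "eqv (Z nr) r (opCz G2 \<psi> + opD G2 (Cq1 G1 v + Dqw G1 w))"
  shows "eqv (Z (n1 + n2)) (opTw I w + opT I (zappend n1 v \<psi>))
      (zappend n1 (T1r G1 r + T1w G1 w + T1 G1 v) (opTw G2 q + opT G2 \<psi>))"
    and "eqv (Z (n1 + n2)) (opA I (zappend n1 v \<psi>) + opBw I w)
      (zappend n1 (A1 G1 v + B1w G1 w + B1r G1 r) (opA G2 \<psi> + opBw G2 q))"
    and "eqv (Z nz) (opCz I (zappend n1 v \<psi>) + opD I w) (Cz1 G1 v + Dzw G1 w + Dzr G1 r)"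
proof -
  define v' where "v' = ztake n1 (zappend n1 v \<psi>)"
  have v': "eqv (Z n1) v' v"
    using ztake_zappend v \<psi> unfolding v'_def Z_def by blast
  note o1 = is_pie2_bounded_op[OF G1, folded Z_def] and o2 = is_pie_bounded_op[OF G2, folded Z_def]
  have Z: "sqspace (Z n)" for n unfolding Z_def by (rule sqspace_Zsqspace)
  note first = closed_loop_first[OF Z Z Z Z _ _ _ o1(10,11) o2(5,6) v w \<psi> v' r]
  note second = closed_loop_second[OF Z Z Z _ _ o1(10,11) v w \<psi> v' q]
  have iff: "eqv (Z (n1 + n2)) (zappend n1 x y) (zappend n1 x' y') \<longleftrightarrow> eqv (Z n1) x x' \<and> eqv (Z n2) y y'"
    for x y x' y' unfolding Z_def by (rule eqv_zappend_iff)
  note defs = I_def interconnection_def block_col_def block_row_def zappend_linear zdrop_zappend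
    plus_fun_apply comp_def v'_def[symmetric]
  show "eqv (Z (n1 + n2)) (opTw I w + opT I (zappend n1 v \<psi>))
      (zappend n1 (T1r G1 r + T1w G1 w + T1 G1 v) (opTw G2 q + opT G2 \<psi>))"
    using first[OF o1(1-3)] second[OF o2(2,1)]
    by (simp add: defs iff)
  show "eqv (Z (n1 + n2)) (opA I (zappend n1 v \<psi>) + opBw I w)
      (zappend n1 (A1 G1 v + B1w G1 w + B1r G1 r) (opA G2 \<psi> + opBw G2 q))"
    using first[OF o1(6,5,4)] second[OF o2(4,3)]
    by (simp add: defs iff) (simp add: ac_simps)
  show "eqv (Z nz) (opCz I (zappend n1 v \<psi>) + opD I w) (Cz1 G1 v + Dzw G1 w + Dzr G1 r)"
    using first[OF o1(9,8,7)] by (simp add: defs) (simp add: ac_simps)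
qed

lemma interconnection_equations:
  assumes v: "v \<in> carr (Z n1)" and \<psi>: "\<psi> \<in> carr (Z n2)" and w: "w \<in> carr (Z nw)"
    and q: "eqv (Z nq) q (Cq1 G1 v + Dqw G1 w)"
    and r: "eqv (Z nr) r (opCz G2 \<psi> + opD G2 (Cq1 G1 v + Dqw G1 w))"
    and v': "v' \<in> carr (Z n1)" and \<psi>': "\<psi>' \<in> carr (Z n2)" and w': "w' \<in> carr (Z nw)"
    and q': "eqv (Z nq) q' (Cq1 G1 v' + Dqw G1 w')"
    and r': "eqv (Z nr) r' (opCz G2 \<psi>' + opD G2 (Cq1 G1 v' + Dqw G1 w'))"
    and z: "z \<in> carr (Z nz)"
  shows "zeq a b c d (n1 + n2) (opTw I w' + opT I (zappend n1 v' \<psi>')) (opA I (zappend n1 v \<psi>) + opBw I w)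
      \<longleftrightarrow> zeq a b c d n1 (T1r G1 r' + T1w G1 w' + T1 G1 v') (A1 G1 v + B1w G1 w + B1r G1 r) \<and>
          zeq a b c d n2 (opTw G2 q' + opT G2 \<psi>') (opA G2 \<psi> + opBw G2 q)"
    and "zeq a b c d nz z (opCz I (zappend n1 v \<psi>) + opD I w)
      \<longleftrightarrow> zeq a b c d nz z (Cz1 G1 v + Dzw G1 w + Dzr G1 r)"
proof -
  note red = interconnection_reduces[OF v \<psi> w q r] and red' = interconnection_reduces[OF v' \<psi>' w' q' r']
  have Z: "sqspace (Z n)" for n unfolding Z_def by (rule sqspace_Zsqspace)
  have zeq: "zeq a b c d n x y \<longleftrightarrow> eqv (Z n) x y" if "x \<in> carr (Z n)" "y \<in> carr (Z n)" for n x y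
    using that zeq_iff_eqv unfolding Z_def carr_Zspace by blast
  have iff: "eqv (Z (n1 + n2)) (zappend n1 x y) (zappend n1 x' y') \<longleftrightarrow> eqv (Z n1) x x' \<and> eqv (Z n2) y y'"
    for x y x' y' unfolding Z_def by (rule eqv_zappend_iff)
  have mem: "zappend n1 x y \<in> carr (Z (n1 + n2)) \<longleftrightarrow> x \<in> carr (Z n1) \<and> y \<in> carr (Z n2)" for x y
    unfolding Z_def by (rule zappend_carr_sqnorm)
  show "zeq a b c d (n1 + n2) (opTw I w' + opT I (zappend n1 v' \<psi>')) (opA I (zappend n1 v \<psi>) + opBw I w)
      \<longleftrightarrow> zeq a b c d n1 (T1r G1 r' + T1w G1 w' + T1 G1 v') (A1 G1 v + B1w G1 w + B1r G1 r) \<and>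
          zeq a b c d n2 (opTw G2 q' + opT G2 \<psi>') (opA G2 \<psi> + opBw G2 q)"
    using eqv_carr[OF red'(1)] eqv_carr[OF red(2)] eqv_cong[OF Z red'(1) red(2)]
    by (simp add: zeq iff mem)
  show "zeq a b c d nz z (opCz I (zappend n1 v \<psi>) + opD I w)
      \<longleftrightarrow> zeq a b c d nz z (Cz1 G1 v + Dzw G1 w + Dzr G1 r)"
    using eqv_carr[OF red(3)] eqv_cong[OF Z eqv_refl[OF Z z] red(3)] z
    by (simp add: zeq)
qed

text \<open>
  \<open>q\<close> and \<open>r\<close> are bounded linear images of \<open>v\<close>, \<open>\<psi>\<close>, \<open>w\<close>, and hence are differentiable when these are;
  this supplies the derivatives of the internal signals that the interconnection does not mention.
\<close>
lemma signal_derivatives: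
  assumes t: "0 \<le> t" and v: "\<And>s. 0 \<le> s \<Longrightarrow> v s \<in> carr (Z n1)" and \<psi>: "\<And>s. 0 \<le> s \<Longrightarrow> \<psi> s \<in> carr (Z n2)"
    and w: "\<And>s. 0 \<le> s \<Longrightarrow> w s \<in> carr (Z nw)"
    and q: "\<And>s. 0 \<le> s \<Longrightarrow> eqv (Z nq) (q s) (Cq1 G1 (v s) + Dqw G1 (w s))"
    and r: "\<And>s. 0 \<le> s \<Longrightarrow> eqv (Z nr) (r s) (opCz G2 (\<psi> s) + opD G2 (Cq1 G1 (v s) + Dqw G1 (w s)))"
    and v': "sqderiv (Z n1) v v' t" and \<psi>': "sqderiv (Z n2) \<psi> \<psi>' t" and w': "sqderiv (Z nw) w w' t"
  shows "sqderiv (Z nq) q (Cq1 G1 v' + Dqw G1 w') t"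
    and "sqderiv (Z nr) r (opCz G2 \<psi>' + opD G2 (Cq1 G1 v' + Dqw G1 w')) t"
proof -
  have Z: "sqspace (Z n)" for n unfolding Z_def by (rule sqspace_Zsqspace)
  note o1 = is_pie2_bounded_op[OF G1, folded Z_def] and o2 = is_pie_bounded_op[OF G2, folded Z_def]
  have mem: "Cq1 G1 (v s) + Dqw G1 (w s) \<in> carr (Z nq)" if "0 \<le> s" for s
    using eqv_carr(2)[OF q[OF that]] .
  have Q: "sqderiv (Z nq) (\<lambda>s. Cq1 G1 (v s) + Dqw G1 (w s)) (Cq1 G1 v' + Dqw G1 w') t"
    by (intro sqderiv_add[OF Z _ _ t] sqderiv_bounded_op[OF Z Z o1(10) v' t] sqderiv_bounded_op[OF Z Z o1(11) w' t]
        bounded_op_carr[OF o1(10)] bounded_op_carr[OF o1(11)] v w)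
  show "sqderiv (Z nq) q (Cq1 G1 v' + Dqw G1 w') t"
    by (rule sqderiv_cong[OF Z Q t q])
  have R: "sqderiv (Z nr) (\<lambda>s. opCz G2 (\<psi> s) + opD G2 (Cq1 G1 (v s) + Dqw G1 (w s)))
      (opCz G2 \<psi>' + opD G2 (Cq1 G1 v' + Dqw G1 w')) t"
    by (intro sqderiv_add[OF Z _ _ t] sqderiv_bounded_op[OF Z Z o2(5) \<psi>' t] sqderiv_bounded_op[OF Z Z o2(6) Q t]
        bounded_op_carr[OF o2(5)] bounded_op_carr[OF o2(6)] \<psi> mem)
  show "sqderiv (Z nr) r (opCz G2 \<psi>' + opD G2 (Cq1 G1 v' + Dqw G1 w')) t"
    by (rule sqderiv_cong[OF Z R t r])
qed

end

theorem proposition17: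
  fixes a b c d :: real
    and n1 n2 nw nz nq nr :: "nat \<times> nat \<times> nat \<times> nat"
    and G1 :: pie2 and G2 :: pie
    and v \<psi> w z q r :: "real \<Rightarrow> zfun"
    and v0 \<psi>0 :: zfun
  assumes "a \<le> b" and "c \<le> d"
    and "is_pie2 a b c d n1 nw nr nz nq G1"
    and "is_pie a b c d n2 nq nr G2"
    and "v0 \<in> Zspace a b c d n1"
    and "\<psi>0 \<in> Zspace a b c d n2"
    and "\<And>t. 0 \<le> t \<Longrightarrow> w t \<in> Zspace a b c d nw"
    and "\<And>t. 0 \<le> t \<Longrightarrow> q t \<in> Zspace a b c d nq"
    and "\<And>t. 0 \<le> t \<Longrightarrow> r t \<in> Zspace a b c d nr"
    and "\<And>t. 0 \<le> t \<Longrightarrow> zeq a b c d nq (q t) (Cq1 G1 (v t) + Dqw G1 (w t))"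
    and "\<And>t. 0 \<le> t \<Longrightarrow>
           zeq a b c d nr (r t) (opCz G2 (\<psi> t) + opD G2 (Cq1 G1 (v t) + Dqw G1 (w t)))"
  shows "solves_pie a b c d (n1 + n2) nw nz (interconnection n1 G1 G2)
           (zappend n1 v0 \<psi>0) w (\<lambda>t. zappend n1 (v t) (\<psi> t)) z
         \<longleftrightarrow>
         solves_pie2 a b c d n1 nw nr nz nq G1 v0 w r v z q \<and>
         solves_pie a b c d n2 nq nr G2 \<psi>0 q \<psi> r"
proof -
  define Z where "Z = Zsqspace a b c d"
  let ?I = "interconnection n1 G1 G2"
  note G = assms(3,4)
  have Z: "sqspace (Z n)" for n unfolding Z_def by (rule sqspace_Zsqspace)
  have Zspace: "Zspace a b c d n = carr (Z n)" for n unfolding Z_def by (rule carr_Zspace[symmetric])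
  have zderiv: "zderiv a b c d n = sqderiv (Z n)" for n
    unfolding Z_def by (intro ext zderiv_iff_sqderiv)
  have zeq: "zeq a b c d n x y \<longleftrightarrow> eqv (Z n) x y" if "x \<in> carr (Z n)" "y \<in> carr (Z n)" for n x y
    using that zeq_iff_eqv unfolding Z_def carr_Zspace by blast
  have mem_append: "zappend n1 x y \<in> carr (Z (n1 + n2)) \<longleftrightarrow> x \<in> carr (Z n1) \<and> y \<in> carr (Z n2)" for x y
    unfolding Z_def by (rule zappend_carr_sqnorm)
  note o1 = is_pie2_bounded_op[OF assms(3), folded Z_def] and o2 = is_pie_bounded_op[OF assms(4), folded Z_def]
  note equations = interconnection_equations[OF G, folded Z_def]
    and derivatives = signal_derivatives[OF G, folded Z_def]
  note w = assms(7)[unfolded Zspace] and q = assms(8)[unfolded Zspace] and r = assms(9)[unfolded Zspace]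
  show ?thesis
  \<comment> \<open>Both sides of the equivalence require these memberships, so they may be assumed.\<close>
  proof (cases "\<forall>t\<ge>0. v t \<in> carr (Z n1) \<and> \<psi> t \<in> carr (Z n2) \<and> z t \<in> carr (Z nz)")
    case False
    then show ?thesis
      by (auto simp: solves_pie_def solves_pie2_def Zspace mem_append)
  next
    case True
    then have v: "\<And>t. 0 \<le> t \<Longrightarrow> v t \<in> carr (Z n1)" and \<psi>: "\<And>t. 0 \<le> t \<Longrightarrow> \<psi> t \<in> carr (Z n2)"
      and z: "\<And>t. 0 \<le> t \<Longrightarrow> z t \<in> carr (Z nz)" by auto
    have qmem: "Cq1 G1 (v t) + Dqw G1 (w t) \<in> carr (Z nq)" if "0 \<le> t" for t
      using that by (intro sqspace_closed(2)[OF Z] bounded_op_carr[OF o1(10)] bounded_op_carr[OF o1(11)] v w)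
    have q_eq: "eqv (Z nq) (q t) (Cq1 G1 (v t) + Dqw G1 (w t))" if "0 \<le> t" for t
      using assms(10)[OF that] zeq[OF q[OF that] qmem[OF that]] by simp
    have r_eq: "eqv (Z nr) (r t) (opCz G2 (\<psi> t) + opD G2 (Cq1 G1 (v t) + Dqw G1 (w t)))" if "0 \<le> t" for t
    proof -
      have "opCz G2 (\<psi> t) + opD G2 (Cq1 G1 (v t) + Dqw G1 (w t)) \<in> carr (Z nr)"
        using that by (intro sqspace_closed(2)[OF Z] bounded_op_carr[OF o2(5)] bounded_op_carr[OF o2(6)] \<psi> qmem)
      then show ?thesis using assms(11)[OF that] zeq[OF r[OF that]] by simp
    qed
    have r_output: "zeq a b c d nr (r t) (opCz G2 (\<psi> t) + opD G2 (q t))" if t: "0 \<le> t" for t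
    proof -
      have "eqv (Z nr) (opD G2 (Cq1 G1 (v t) + Dqw G1 (w t))) (opD G2 (q t))"
        by (rule bounded_op_eqv[OF Z Z o2(6) eqv_sym[OF Z q_eq[OF t]]])
      then have "eqv (Z nr) (r t) (opCz G2 (\<psi> t) + opD G2 (q t))"
        by (intro eqv_trans[OF Z r_eq[OF t]] eqv_add[OF Z] eqv_refl[OF Z] bounded_op_carr[OF o2(5)] \<psi> t)
      then show ?thesis using zeq eqv_carr by blast
    qed
    have init: "zeq a b c d (n1 + n2) (zappend n1 (v 0) (\<psi> 0)) (zappend n1 v0 \<psi>0)
        \<longleftrightarrow> zeq a b c d n1 (v 0) v0 \<and> zeq a b c d n2 (\<psi> 0) \<psi>0"
      using v[of 0] \<psi>[of 0] assms(5,6) eqv_zappend_iff[of a b c d n1 n2, folded Z_def]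
      by (simp add: zeq mem_append Zspace)
    have "(\<exists>xt wt. sqderiv (Z (n1 + n2)) (\<lambda>t. zappend n1 (v t) (\<psi> t)) xt t \<and> sqderiv (Z nw) w wt t \<and>
            zeq a b c d (n1 + n2) (opTw ?I wt + opT ?I xt) (opA ?I (zappend n1 (v t) (\<psi> t)) + opBw ?I (w t)) \<and>
            zeq a b c d nz (z t) (opCz ?I (zappend n1 (v t) (\<psi> t)) + opD ?I (w t)))
      \<longleftrightarrow> (\<exists>vt wt rt. sqderiv (Z n1) v vt t \<and> sqderiv (Z nw) w wt t \<and> sqderiv (Z nr) r rt t \<and>
            zeq a b c d n1 (T1r G1 rt + T1w G1 wt + T1 G1 vt) (A1 G1 (v t) + B1w G1 (w t) + B1r G1 (r t)) \<and>
            zeq a b c d nz (z t) (Cz1 G1 (v t) + Dzw G1 (w t) + Dzr G1 (r t))) \<and>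
          (\<exists>\<psi>t qt. sqderiv (Z n2) \<psi> \<psi>t t \<and> sqderiv (Z nq) q qt t \<and>
            zeq a b c d n2 (opTw G2 qt + opT G2 \<psi>t) (opA G2 (\<psi> t) + opBw G2 (q t)))"
      (is "?L \<longleftrightarrow> ?R1 \<and> ?R2") if t: "0 \<le> t" for t
    proof
      note eqs = equations[OF v[OF t] \<psi>[OF t] w[OF t] q_eq[OF t] r_eq[OF t] _ _ _ _ _ z[OF t]]
      note dvs = derivatives[OF t v \<psi> w q_eq r_eq]
      {
        assume ?L
        then obtain xt wt where x: "sqderiv (Z (n1 + n2)) (\<lambda>t. zappend n1 (v t) (\<psi> t)) xt t"
          and wt: "sqderiv (Z nw) w wt t" and
          e: "zeq a b c d (n1 + n2) (opTw ?I wt + opT ?I xt) (opA ?I (zappend n1 (v t) (\<psi> t)) + opBw ?I (w t))"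
             "zeq a b c d nz (z t) (opCz ?I (zappend n1 (v t) (\<psi> t)) + opD ?I (w t))"
          by blast
        define vt \<psi>t where "vt = ztake n1 xt" and "\<psi>t = zdrop n1 xt"
        \<comment> \<open>Every element of the joint space is an exact concatenation, so a joint derivative can be split.\<close>
        have xt: "xt = zappend n1 vt \<psi>t"
          by (simp add: vt_def \<psi>t_def zappend_take_drop)
        have d: "sqderiv (Z n1) v vt t" "sqderiv (Z n2) \<psi> \<psi>t t"
          using x sqderiv_zappend_iff[OF t v[unfolded Z_def] \<psi>[unfolded Z_def]] unfolding xt Z_def by simp_all
        note dq = dvs(1)[OF _ _ _ _ _ d wt] and dr = dvs(2)[OF _ _ _ _ _ d wt]
        show "?R1 \<and> ?R2"
          using eqs[OF sqderiv_carr[OF d(1)] sqderiv_carr[OF d(2)] sqderiv_carr[OF wt]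
              eqv_refl[OF Z sqderiv_carr[OF dq]] eqv_refl[OF Z sqderiv_carr[OF dr]]] d wt dq dr e[unfolded xt]
          by blast
      }
      assume "?R1 \<and> ?R2"
      then obtain vt wt rt \<psi>t qt where d: "sqderiv (Z n1) v vt t" "sqderiv (Z n2) \<psi> \<psi>t t"
        and wt: "sqderiv (Z nw) w wt t" and dr: "sqderiv (Z nr) r rt t" and dq: "sqderiv (Z nq) q qt t" and
        e: "zeq a b c d n1 (T1r G1 rt + T1w G1 wt + T1 G1 vt) (A1 G1 (v t) + B1w G1 (w t) + B1r G1 (r t))"
           "zeq a b c d nz (z t) (Cz1 G1 (v t) + Dzw G1 (w t) + Dzr G1 (r t))"
           "zeq a b c d n2 (opTw G2 qt + opT G2 \<psi>t) (opA G2 (\<psi> t) + opBw G2 (q t))"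
        by blast
      \<comment> \<open>The two systems come with derivatives of \<open>q\<close> and \<open>r\<close> of their own; by uniqueness these obey the
        same relations as the signals.\<close>
      have qt: "eqv (Z nq) qt (Cq1 G1 vt + Dqw G1 wt)"
        by (rule sqderiv_unique[OF Z dq dvs(1)[OF _ _ _ _ _ d wt] t q])
      have rt: "eqv (Z nr) rt (opCz G2 \<psi>t + opD G2 (Cq1 G1 vt + Dqw G1 wt))"
        by (rule sqderiv_unique[OF Z dr dvs(2)[OF _ _ _ _ _ d wt] t r])
      have "sqderiv (Z (n1 + n2)) (\<lambda>t. zappend n1 (v t) (\<psi> t)) (zappend n1 vt \<psi>t) t"
        using d sqderiv_zappend_iff[OF t v[unfolded Z_def] \<psi>[unfolded Z_def]] unfolding Z_def by simp
      then show ?L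
        using eqs[OF sqderiv_carr[OF d(1)] sqderiv_carr[OF d(2)] sqderiv_carr[OF wt] qt rt] wt e by blast
    qed
    then show ?thesis
      using v \<psi> z q r q_eq assms(10) r_output init
      unfolding solves_pie_def solves_pie2_def Zspace zderiv by (auto simp: mem_append)
  qed
qed

end
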